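(* Consider the game and the asymmetric learning algorithm described in the context. Suppose the game is $m$-strongly monotone with $m>0$, i.e. for all $x,x'\in\mathcal X$, $$\sum_{i=1}^N\langle\nabla_i\mathcal C_i(x)-\nabla_i\mathcal C_i(x'),\,x_i-x_i'\rangle\ \ge\ m\|x-x'\|^2.$$ Assume the following. (i) For each $i\in\mathcal N$, $\mathcal C_i(x_i,x_{-i})$ is convex in $x_i$ for all $x_{-i}\in\mathcal X_{-i}=\prod_{j\ne i}\mathcal X_j$. Moreover each $\mathcal X_i$ contains the ball of radius $r>0$ centered at the origin and has bounded diameter $D>0$. (ii) There is $U>0$ such that $|\mathcal C_i(x)|\le U$ for all $i\in\mathcal N$ and $x\in\mathcal X$. (iii) There is $L_0>0$ such that $|\mathcal C_i(x)-\mathcal C_i(y)|\le L_0\|x-y\|$ for all $i\in\mathcal N$ and $x,y\in\mathcal X$. (iv) There is $L_1>0$ such that $\|\nabla_i\mathcal C_i(x)-\nabla_i\mathcal C_i(y)\|\le L_1\|x-y\|$ for all $i\in\mathcal N$ and $x,y\in\mathcal X$. Select, for all $t=1,\dots,T$, $$\delta_t=\frac{N_z^{1/6}}{N^{1/3}t^{1/3}},\qquad \eta_{z,t}=\eta_{f,t}=\frac1{mt}.$$ Let $x^*$ be the (unique) Nash equilibrium of the game. Then the iterates of the algorithm satisfy $$\mathbb E\|x_T-x^*\|^2=\mathcal O\Big(N_z^{2/3}N^{2/3}T^{-1/3}+(N-N_z)T^{-1}\Big),$$ where $\mathcal O$ hides all constant factors except for $N$, $N_z$ and $T$. That is, the hidden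 constant may depend on $d,D,r,U,L_0,L_1,m$ but not on $N,N_z,T$.
   Context: **Game.** There are $N$ agents, $\mathcal N=\{1,\dots,N\}$. Agent $i$ chooses $x_i\in\mathcal X_i$, where $\mathcal X_i\subset\mathbb R^d$ ($d>0$) is a closed convex set. The joint action space is $\mathcal X=\prod_{i=1}^N\mathcal X_i$. Agent $i$ has cost $\mathcal C_i:\mathcal X\to\mathbb R$, written $\mathcal C_i(x)=\mathcal C_i(x_i,x_{-i})$, where $x_{-i}$ collects the actions of all agents other than $i$. Each agent wants to minimize $\mathcal C_i(x_i,x_{-i})$ over $x_i\in\mathcal X_i$. $\nabla_i\mathcal C_i$ denotes the gradient of $\mathcal C_i$ with respect to $x_i$. $\|\cdot\|$ is the Euclidean norm. The order in which blocks of actions are listed as arguments of $\mathcal C_i$ is immaterial. A Nash equilibrium is a point $x^*\in\mathcal X$ with $\mathcal C_i(x^* )\le\mathcal C_i(x_i,x^*_{-i})$ for all $x_i\in\mathcal X_i$ and $i\in\mathcal N$. It is a known result (Rosen) that a strongly monotone game as in the claim has a unique Nash equilibrium. **Two kinds of agents.** Let $0\le N_z\le N$. Agents in $\mathcal N_z=\{1,\dots,N_z\}$ have access only to zeroth-order oracles (values of their cost). Agents in $\mathcal N_f=\{N_z+1,\dots,N\}$ have first-order gradient information. (If $N_z=0$ then $\mathcal N_z=\emptyset$; if $N_z=N$ then $\mathcal N_f=\emptyset$.) **Asymmetric learning algorithm.** The inputs are sequences $\eta_{f,t},\eta_{z,t},\delta_t$ and an initial (deterministic) point $x_1\in\mathcal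 X$. For $0<\delta<r$ put $\mathcal X_{i}^{\delta}=\{x_i\in\mathcal X_i:\ \tfrac{1}{1-\delta/r}x_i\in\mathcal X_i\}$. $\mathcal P_K$ denotes Euclidean projection onto $K$. $\mathbb S$ is the unit sphere in $\mathbb R^d$. At each episode $t=1,\dots,T$: 1. Each $i_z\in\mathcal N_z$ samples $u_{i_z,t}$ uniformly from $\mathbb S$ (independently across agents and episodes) and plays $\hat x_{i_z,t}=x_{i_z,t}+\delta_t u_{i_z,t}$. Each $i_f\in\mathcal N_f$ plays $x_{i_f,t}$. Write $\hat x_{z,t}=(\hat x_{1,t},\dots,\hat x_{N_z,t})$ and $x_{f,t}=(x_{N_z+1,t},\dots,x_{N,t})$. 2. Each $i_z$ observes $\mathcal C_{i_z}(\hat x_{z,t},x_{f,t})$. Each $i_f$ observes $\nabla_{i_f}\mathcal C_{i_f}(x_{f,t},\hat x_{z,t})$. 3. Updates: $x_{i_z,t+1}=\mathcal P_{\mathcal X_{i_z}^{\delta_t}}\big(x_{i_z,t}-\eta_{z,t}g_{i_z,t}\big)$ with $g_{i_z,t}=\frac{d}{\delta_t}\mathcal C_{i_z}(\hat x_{z,t},x_{f,t})\,u_{i_z,t}$, and $x_{i_f,t+1}=\mathcal P_{\mathcal X_{i_f}}\big(x_{i_f,t}-\eta_{f,t}\nabla_{i_f}\mathcal C_{i_f}(x_{f,t},\hat x_{z,t})\big)$. The played actions are required to be feasible: when $N_z\ge1$, $\delta_t<r$ for all $t$ and $x_{i_z,1}\in\mathcal X_{i_z}^{\delta_1}$ for $i_z\in\mathcal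 N_z$. If $N_z=0$, $\delta_t$ and $\eta_{z,t}$ are not used. $x_t=(x_{1,t},\dots,x_{N,t})$ is the vector of (unperturbed) iterates. The expectation is over the random directions $u_{i_z,t}$. *)

theory Defs
  imports "HOL-Probability.Probability"
begin

text \<open>
  Agents are the numbers in \<open>{1..N}\<close>; the first \<open>Nz\<close> of them are the zeroth-order agents.
  The space \<open>\<real>\<^sup>d\<close> is a type \<open>'a :: euclidean_space\<close> with \<open>d = DIM('a)\<close>. The number of agents is a
  variable, so a joint action is an extensional function on \<open>{1..N}\<close>. A cost function is only
  constrained on joint actions; its values elsewhere are irrelevant.
\<close>

definition joint_actions :: "nat \<Rightarrow> (nat \<Rightarrow> 'a set) \<Rightarrow> (nat \<Rightarrow> 'a) set" where
  "joint_actions N X = (\<Pi>\<^sub>E i\<in>{1..N}. X i)"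

definition joint_dist :: "nat \<Rightarrow> (nat \<Rightarrow> 'a::euclidean_space) \<Rightarrow> (nat \<Rightarrow> 'a) \<Rightarrow> real" where
  "joint_dist N x y = L2_set (\<lambda>i. norm (x i - y i)) {1..N}"

text \<open>
  \<open>G i x\<close> is the gradient of \<open>C i\<close> with respect to the \<open>i\<close>-th action at \<open>x\<close>. Costs live on the
  joint action set only, so the derivative is taken within \<open>X i\<close>. If \<open>X i\<close> is convex with
  nonempty interior, this determines \<open>G i x\<close> uniquely, also at boundary points.
\<close>

definition is_own_gradient ::
  "nat \<Rightarrow> (nat \<Rightarrow> 'a::euclidean_space set) \<Rightarrow> (nat \<Rightarrow> (nat \<Rightarrow> 'a) \<Rightarrow> real)
    \<Rightarrow> (nat \<Rightarrow> (nat \<Rightarrow> 'a) \<Rightarrow> 'a) \<Rightarrow> bool" where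
  "is_own_gradient N X C G \<longleftrightarrow>
    (\<forall>i\<in>{1..N}. \<forall>x\<in>joint_actions N X.
      ((\<lambda>y. C i (x(i := y))) has_derivative (\<lambda>h. G i x \<bullet> h)) (at (x i) within X i))"

definition strongly_monotone ::
  "nat \<Rightarrow> (nat \<Rightarrow> 'a::euclidean_space set) \<Rightarrow> (nat \<Rightarrow> (nat \<Rightarrow> 'a) \<Rightarrow> 'a) \<Rightarrow> real \<Rightarrow> bool" where
  "strongly_monotone N X G m \<longleftrightarrow>
    (\<forall>x\<in>joint_actions N X. \<forall>x'\<in>joint_actions N X.
      (\<Sum>i=1..N. (G i x - G i x') \<bullet> (x i - x' i)) \<ge> m * (joint_dist N x x')\<^sup>2)"

definition nash_equilibrium ::
  "nat \<Rightarrow> (nat \<Rightarrow> 'a set) \<Rightarrow> (nat \<Rightarrow> (nat \<Rightarrow> 'a) \<Rightarrow> real) \<Rightarrow> (nat \<Rightarrow> 'a) \<Rightarrow> bool" where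
  "nash_equilibrium N X C x \<longleftrightarrow>
    x \<in> joint_actions N X \<and> (\<forall>i\<in>{1..N}. \<forall>y\<in>X i. C i x \<le> C i (x(i := y)))"

definition shrunk_set :: "real \<Rightarrow> real \<Rightarrow> 'a::euclidean_space set \<Rightarrow> 'a set" where
  "shrunk_set r \<delta> S = {x \<in> S. (1 / (1 - \<delta> / r)) *\<^sub>R x \<in> S}"

text \<open>
  The normalised surface measure of the unit sphere, as the law of the direction of a uniformly
  distributed point of the unit ball. The underlying space is restricted to the sphere, so that
  perturbed actions are feasible everywhere and not merely almost everywhere.
\<close>

definition uniform_sphere :: "'a::euclidean_space measure" where
  "uniform_sphere =
    restrict_space (distr (uniform_measure lborel (ball 0 1)) borel sgn) (sphere 0 1)"

lemma prob_space_uniform_sphere: "prob_space (uniform_sphere :: 'a::euclidean_space measure)"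
proof -
  let ?B = "ball (0::'a) 1" and ?S = "sphere (0::'a) 1"
  let ?U = "uniform_measure lborel ?B"
  have fin: "emeasure lborel ?B \<noteq> \<infinity>"
    using emeasure_lborel_ball_finite[of "0::'a" 1] by simp
  have pos: "emeasure lborel ?B \<noteq> 0"
    using content_ball_pos[of 1 "0::'a"] by (auto simp: measure_def)
  have eq: "?B \<inter> sgn -` ?S = ?B - {0}"
    by (auto simp: norm_sgn)
  have S: "?S \<in> sets borel" by simp
  have m: "sgn \<in> measurable ?U borel" by simp
  have meas: "sgn -` ?S \<in> sets (borel :: 'a measure)"
    using measurable_sets[OF m S] by simp
  have "emeasure (distr ?U borel sgn) ?S = emeasure ?U (sgn -` ?S)"
    by (simp add: emeasure_distr[OF m S])
  also have "\<dots> = emeasure lborel (?B - {0}) / emeasure lborel ?B"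
    using meas by (simp add: eq)
  also have "emeasure lborel (?B - {0}) = emeasure lborel ?B"
    by (rule emeasure_Diff_null_set) auto
  finally have "emeasure (distr ?U borel sgn) ?S = 1"
    using fin pos by (simp add: ennreal_divide_self top.not_eq_extremum)
  then show ?thesis
    unfolding uniform_sphere_def
    by (intro prob_spaceI) (simp add: emeasure_restrict_space space_restrict_space)
qed

text \<open>The joint law of the directions: \<open>\<omega> (i, t)\<close> is the direction of agent \<open>i\<close> in episode \<open>t\<close>.\<close>

definition directions :: "nat \<Rightarrow> nat \<Rightarrow> (nat \<times> nat \<Rightarrow> 'a::euclidean_space) measure" where
  "directions Nz T = (\<Pi>\<^sub>M p\<in>{1..Nz} \<times> {1..T}. uniform_sphere)"

definition played :: "nat \<Rightarrow> real \<Rightarrow> (nat \<Rightarrow> 'a::euclidean_space) \<Rightarrow> (nat \<Rightarrow> 'a) \<Rightarrow> nat \<Rightarrow> 'a" where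
  "played Nz \<delta> u x = (\<lambda>i. if i \<in> {1..Nz} then x i + \<delta> *\<^sub>R u i else x i)"

definition asym_step ::
  "nat \<Rightarrow> nat \<Rightarrow> (nat \<Rightarrow> 'a::euclidean_space set) \<Rightarrow> (nat \<Rightarrow> (nat \<Rightarrow> 'a) \<Rightarrow> real)
    \<Rightarrow> (nat \<Rightarrow> (nat \<Rightarrow> 'a) \<Rightarrow> 'a) \<Rightarrow> real \<Rightarrow> real \<Rightarrow> real \<Rightarrow> real \<Rightarrow> (nat \<Rightarrow> 'a) \<Rightarrow> (nat \<Rightarrow> 'a)
    \<Rightarrow> nat \<Rightarrow> 'a" where
  "asym_step N Nz X C G r \<delta> \<eta>z \<eta>f u x =
    (let xh = played Nz \<delta> u x in
      (\<lambda>i\<in>{1..N}.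
        if i \<le> Nz
        then closest_point (shrunk_set r \<delta> (X i))
               (x i - \<eta>z *\<^sub>R ((real DIM('a) / \<delta> * C i xh) *\<^sub>R u i))
        else closest_point (X i) (x i - \<eta>f *\<^sub>R G i xh)))"

text \<open>Episodes are counted from 1; the value at index 0 is a dummy.\<close>

primrec asym_iterate ::
  "nat \<Rightarrow> nat \<Rightarrow> (nat \<Rightarrow> 'a::euclidean_space set) \<Rightarrow> (nat \<Rightarrow> (nat \<Rightarrow> 'a) \<Rightarrow> real)
    \<Rightarrow> (nat \<Rightarrow> (nat \<Rightarrow> 'a) \<Rightarrow> 'a) \<Rightarrow> real \<Rightarrow> (nat \<Rightarrow> real) \<Rightarrow> (nat \<Rightarrow> real) \<Rightarrow> (nat \<Rightarrow> real)
    \<Rightarrow> (nat \<Rightarrow> 'a) \<Rightarrow> (nat \<times> nat \<Rightarrow> 'a) \<Rightarrow> nat \<Rightarrow> nat \<Rightarrow> 'a" where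
  "asym_iterate N Nz X C G r \<delta> \<eta>z \<eta>f x1 \<omega> 0 = x1"
| "asym_iterate N Nz X C G r \<delta> \<eta>z \<eta>f x1 \<omega> (Suc t) =
    (if t = 0 then x1
     else asym_step N Nz X C G r (\<delta> t) (\<eta>z t) (\<eta>f t) (\<lambda>i. \<omega> (i, t))
            (asym_iterate N Nz X C G r \<delta> \<eta>z \<eta>f x1 \<omega> t))"

end

theory Submission
  imports Defs
begin

text \<open>
  The Lyapunov function is the squared distance of the iterates to the equilibrium shrunk by
  \<open>1 - \<delta>\<^sub>t / r\<close> in the zeroth-order blocks. Nonexpansiveness of the projections, strong monotonicity and
  the variational inequality at the equilibrium contract it by \<open>1 - 2 / t\<close> per episode. The errors are the
  bias of the gradient estimates, \<open>O(N \<surd>N\<^sub>z \<delta>\<^sub>t / t)\<close> in total, their second moment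
  \<open>O((N\<^sub>z / \<delta>\<^sub>t\<^sup>2 + N - N\<^sub>z) / t\<^sup>2)\<close>, and the motion of the shrunk equilibrium, \<open>O(N\<^sub>z (\<delta>\<^sub>t - \<delta>\<^sub>t\<^sub>+\<^sub>1))\<close>.
  For the chosen \<open>\<delta>\<^sub>t\<close> all three are \<open>O(1 / t)\<close> times the claimed rate, which decays more slowly than
  \<open>1 - 1 / t\<close> per episode, so the recursion reproduces the rate.
\<close>

section \<open>Moments of the uniform direction\<close>

text \<open>The radius balances bias against second moment:
  \<open>N * sqrt Nz * \<delta> / t = Nz / (\<delta>^2 * t^2)\<close> gives
  \<open>\<delta>^3 = sqrt Nz / (N * t)\<close>, the prescribed choice, and either side is then
  \<open>Nz^(2/3) * N^(2/3) * t^(-1/3)\<close> divided by \<open>t\<close>. The factor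
  \<open>sqrt Nz\<close> in the bias arises because all zeroth-order agents perturb simultaneously:
  the profile moves by up to \<open>\<delta> * sqrt Nz\<close>, and each of the \<open>N\<close>
  gradients feels it. The step size \<open>1 / (m * t)\<close> turns strong monotonicity into the
  contraction \<open>2 / t\<close>; half of it pays for the decay of the rate, the other half
  absorbs the errors. The probabilistic obstacle is that a one-point estimate follows the gradient
  only on average over the agent's own direction, while the iterate is itself random. In place of
  conditional expectations, one coordinate of the product measure is integrated with all others
  frozen; this is legitimate because the iterate of episode \<open>t\<close> does not depend on the
  directions drawn in episode \<open>t\<close>.\<close>

lemma space_uniform_sphere: "space (uniform_sphere :: 'a::euclidean_space measure) = sphere 0 1"
  by (simp add: uniform_sphere_def space_restrict_space)

lemma sets_uniform_sphere:
  "sets (uniform_sphere :: 'a::euclidean_space measure) = sets (restrict_space borel (sphere 0 1))"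
  by (simp add: uniform_sphere_def sets_restrict_space)

lemma borel_measurable_uniform_sphere:
  fixes h :: "'a::euclidean_space \<Rightarrow> 'b::topological_space"
  assumes "h \<in> borel_measurable borel"
  shows "h \<in> borel_measurable (uniform_sphere :: 'a measure)"
  using measurable_restrict_space1[OF assms]
  by (simp add: measurable_cong_sets[OF sets_uniform_sphere refl])

text \<open>A norm-preserving map pulls the unit ball back to itself, so invariance of Lebesgue
  measure survives conditioning on the ball.\<close>

lemma distr_uniform_ball_isometry:
  fixes F :: "'a::euclidean_space \<Rightarrow> 'a"
  assumes lin: "linear F" and iso: "\<And>x. norm (F x) = norm x" and inv: "distr lborel borel F = lborel"
  shows "distr (uniform_measure lborel (ball 0 1)) borel F = uniform_measure lborel (ball 0 1)"
proof (rule measure_eqI)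
  have F: "F \<in> borel_measurable borel"
    using lin by (intro borel_measurable_continuous_onI linear_continuous_on linear_conv_bounded_linear[THEN iffD1])
  fix A assume "A \<in> sets (distr (uniform_measure lborel (ball 0 1)) borel F)"
  then have A: "A \<in> sets borel" by simp
  have FA: "F -` A \<in> sets borel"
    using measurable_sets[OF F A] by simp
  have "emeasure lborel (ball 0 1 \<inter> F -` A) = emeasure lborel (F -` (ball 0 1 \<inter> A) \<inter> space lborel)"
    by (rule arg_cong[where f = "emeasure lborel"]) (auto simp: iso)
  also have "\<dots> = emeasure (distr lborel borel F) (ball 0 1 \<inter> A)"
    using F A by (subst emeasure_distr) auto
  finally have "emeasure lborel (ball 0 1 \<inter> F -` A) = emeasure lborel (ball 0 1 \<inter> A)"
    by (simp add: inv)
  then show "emeasure (distr (uniform_measure lborel (ball 0 1)) borel F) A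
      = emeasure (uniform_measure lborel (ball 0 1)) A"
    using F A FA by (simp add: emeasure_distr)
qed simp

text \<open>Being linear and norm-preserving, \<open>F\<close> commutes with \<open>sgn\<close>, so
  invariance of the uniform ball passes to the law of its direction.\<close>

lemma integral_uniform_sphere_isometry:
  fixes F :: "'a::euclidean_space \<Rightarrow> 'a" and h :: "'a \<Rightarrow> real"
  assumes lin: "linear F" and iso: "\<And>x. norm (F x) = norm x" and inv: "distr lborel borel F = lborel"
    and h: "h \<in> borel_measurable borel"
  shows "(\<integral>u. h (F u) \<partial>uniform_sphere) = (\<integral>u. h u \<partial>uniform_sphere)"
proof -
  let ?U = "uniform_measure lborel (ball (0::'a) 1)"
  let ?k = "\<lambda>u. indicator (sphere 0 1) u * h u"
  have F: "F \<in> borel_measurable borel"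
    using lin by (intro borel_measurable_continuous_onI linear_continuous_on linear_conv_bounded_linear[THEN iffD1])
  have k: "?k \<in> borel_measurable borel"
    using h by (intro borel_measurable_times borel_measurable_indicator) auto
  have eq: "(\<integral>u. g u \<partial>uniform_sphere) = (\<integral>v. indicator (sphere 0 1) (sgn v) * g (sgn v) \<partial>?U)"
    if "g \<in> borel_measurable borel" for g :: "'a \<Rightarrow> real"
    unfolding uniform_sphere_def using that
    by (subst integral_restrict_space, simp)
      (subst integral_distr, auto intro!: borel_measurable_times borel_measurable_indicator)
  have hF: "(\<lambda>u. h (F u)) \<in> borel_measurable borel" using F h by measurable
  have sF: "sgn (F v) = F (sgn v)" for v
    by (simp add: sgn_div_norm iso linear_scale[OF lin])
  have "(\<integral>u. h (F u) \<partial>uniform_sphere) = (\<integral>v. ?k (sgn (F v)) \<partial>?U)"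
    unfolding eq[OF hF] by (rule Bochner_Integration.integral_cong) (auto simp: sF indicator_def iso)
  also have "\<dots> = (\<integral>v. ?k (sgn v) \<partial>distr ?U borel F)"
    using F k by (subst integral_distr) (auto intro!: measurable_compose[OF _ k])
  also have "\<dots> = (\<integral>v. ?k (sgn v) \<partial>?U)"
    by (simp add: distr_uniform_ball_isometry[OF lin iso inv])
  finally show ?thesis by (simp add: eq[OF h])
qed

text \<open>The reflection is diagonal in the standard basis with a single entry -1 and all others
  1, so its Jacobian has absolute value 1.\<close>

lemma lborel_distr_flip:
  fixes b :: "'a::euclidean_space"
  assumes b: "b \<in> Basis"
  shows "distr lborel borel (\<lambda>x. x - (2 * (x \<bullet> b)) *\<^sub>R b) = lborel"
proof -
  let ?c = "\<lambda>j. if j = b then - 1 else 1 :: real"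
  have "(\<Sum>j\<in>Basis. (?c j * (x \<bullet> j)) *\<^sub>R j) = x - (2 * (x \<bullet> b)) *\<^sub>R b" for x
    by (rule euclidean_eqI) (auto simp: inner_sum_left inner_diff_left inner_Basis b if_distrib cong: if_cong)
  moreover have "(lborel :: 'a measure) = density (distr lborel borel (\<lambda>x. 0 + (\<Sum>j\<in>Basis. (?c j * (x \<bullet> j)) *\<^sub>R j))) (\<lambda>_. (\<Prod>j\<in>Basis. \<bar>?c j\<bar>))"
    by (rule lborel_affine_euclidean) auto
  moreover have "(\<Prod>j\<in>(Basis::'a set). \<bar>?c j\<bar>) = 1" by (rule prod.neutral) auto
  ultimately show ?thesis by (simp add: density_1)
qed

text \<open>The formula exchanges the coordinates along \<open>b\<close> and \<open>c\<close>. Being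
  an involution, it pulls a box back to the box with permuted corners, whose side lengths have the
  same product.\<close>

lemma lborel_distr_swap:
  fixes b c :: "'a::euclidean_space"
  assumes b: "b \<in> Basis" and c: "c \<in> Basis"
  shows "distr lborel borel (\<lambda>x. x + (x \<bullet> c - x \<bullet> b) *\<^sub>R (b - c)) = lborel"
proof (rule lborel_eqI[symmetric])
  let ?F = "\<lambda>x. x + (x \<bullet> c - x \<bullet> b) *\<^sub>R (b - c)"
  let ?t = "Transposition.transpose b c"
  have F: "?F x \<bullet> j = x \<bullet> ?t j" if "j \<in> Basis" for x j
    using that b c
    by (auto simp: inner_diff_left inner_add_left inner_Basis Transposition.transpose_def)
  have t: "bij_betw ?t Basis Basis"
    using b c by (intro bij_betw_byWitness[where f' = ?t]) (auto simp: Transposition.transpose_def)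
  fix l u :: 'a assume le: "\<And>j. j \<in> Basis \<Longrightarrow> l \<bullet> j \<le> u \<bullet> j"
  have tB: "?t j \<in> Basis" if "j \<in> Basis" for j using t that by (auto simp: bij_betw_def)
  have "?F -` box l u = box (?F l) (?F u)"
  proof -
    have "x \<in> ?F -` box l u \<longleftrightarrow> x \<in> box (?F l) (?F u)" for x
    proof -
      have "x \<in> ?F -` box l u \<longleftrightarrow> (\<forall>j\<in>Basis. l \<bullet> j < x \<bullet> ?t j \<and> x \<bullet> ?t j < u \<bullet> j)"
        by (simp add: mem_box F)
      also have "\<dots> \<longleftrightarrow> (\<forall>j\<in>Basis. l \<bullet> ?t j < x \<bullet> j \<and> x \<bullet> j < u \<bullet> ?t j)"
        using tB by (metis transpose_involutory)
      also have "\<dots> \<longleftrightarrow> x \<in> box (?F l) (?F u)" by (simp add: mem_box F)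
      finally show ?thesis .
    qed
    then show ?thesis by blast
  qed
  then have "emeasure (distr lborel borel ?F) (box l u) = emeasure lborel (box (?F l) (?F u))"
    by (subst emeasure_distr) auto
  also have "\<dots> = (\<Prod>j\<in>Basis. (?F u - ?F l) \<bullet> j)"
    using le tB by (intro emeasure_lborel_box) (auto simp: F)
  also have "(\<Prod>j\<in>Basis. (?F u - ?F l) \<bullet> j) = (\<Prod>j\<in>Basis. (u - l) \<bullet> ?t j)"
    by (rule prod.cong) (auto simp: F inner_diff_left[of "?F u"] inner_diff_left[of u])
  also have "\<dots> = (\<Prod>j\<in>Basis. (u - l) \<bullet> j)" by (rule prod.reindex_bij_betw[OF t])
  finally show "emeasure (distr lborel borel ?F) (box l u) = (\<Prod>j\<in>Basis. (u - l) \<bullet> j)" .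
qed simp

lemma integrable_uniform_sphere_bounded:
  fixes h :: "'a::euclidean_space \<Rightarrow> real"
  assumes "h \<in> borel_measurable uniform_sphere" "\<And>u. norm u = 1 \<Longrightarrow> \<bar>h u\<bar> \<le> B"
  shows "integrable uniform_sphere h"
proof -
  interpret prob_space "uniform_sphere :: 'a measure" by (rule prob_space_uniform_sphere)
  show ?thesis using assms by (intro integrable_const_bound[where B = B]) (auto simp: space_uniform_sphere)
qed

lemma linear_norm_flip:
  fixes b :: "'a::euclidean_space"
  assumes b: "b \<in> Basis"
  shows "linear (\<lambda>x. x - (2 * (x \<bullet> b)) *\<^sub>R b)" "norm (x - (2 * (x \<bullet> b)) *\<^sub>R b) = norm x"
  using b by (auto intro!: linearI simp: algebra_simps norm_eq inner_diff_left inner_diff_right inner_commute)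

text \<open>The flip along \<open>b\<close> negates \<open>u \<bullet> b\<close> and preserves the
  law, so every coordinate has mean zero.\<close>

lemma integral_uniform_sphere_inner:
  fixes w :: "'a::euclidean_space"
  shows "(\<integral>u. u \<bullet> w \<partial>uniform_sphere) = 0"
proof -
  have int: "integrable uniform_sphere (\<lambda>u. u \<bullet> b)" for b :: 'a
    by (rule integrable_uniform_sphere_bounded[where B = "norm b"])
      (use Cauchy_Schwarz_ineq2[of _ b] in \<open>auto intro!: borel_measurable_uniform_sphere\<close>, metis mult_1)
  have "(\<integral>u. u \<bullet> b \<partial>uniform_sphere) = 0" if b: "b \<in> Basis" for b :: 'a
  proof -
    have "(\<integral>u. (u - (2 * (u \<bullet> b)) *\<^sub>R b) \<bullet> b \<partial>uniform_sphere) = (\<integral>u. u \<bullet> b \<partial>uniform_sphere)"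
      by (rule integral_uniform_sphere_isometry[OF linear_norm_flip[OF b] lborel_distr_flip[OF b]]) simp
    then show ?thesis using b by (simp add: inner_diff_left)
  qed
  then have "(\<integral>u. (\<Sum>b\<in>Basis. (w \<bullet> b) * (u \<bullet> b)) \<partial>uniform_sphere) = 0"
    by (simp add: Bochner_Integration.integral_sum int)
  then show ?thesis
    by (simp add: euclidean_inner[of _ w] mult.commute)
qed

lemma integrable_uniform_sphere_inner2:
  fixes a w :: "'a::euclidean_space"
  shows "integrable uniform_sphere (\<lambda>u. (a \<bullet> u) * (u \<bullet> w))"
proof (rule integrable_uniform_sphere_bounded)
  show "(\<lambda>u. (a \<bullet> u) * (u \<bullet> w)) \<in> borel_measurable (uniform_sphere :: 'a measure)"
    by (rule borel_measurable_uniform_sphere) simp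
  fix u :: 'a assume "norm u = 1"
  then show "\<bar>(a \<bullet> u) * (u \<bullet> w)\<bar> \<le> norm a * norm w"
    unfolding abs_mult using Cauchy_Schwarz_ineq2[of a u] Cauchy_Schwarz_ineq2[of u w]
    by (intro mult_mono) auto
qed

text \<open>The second moment matrix is a multiple of the identity: flips annihilate the
  off-diagonal entries, swaps equalise the diagonal, and the trace is 1 because
  \<open>norm u = 1\<close>. The resulting factor cancels \<open>DIM('a)\<close> in the one-point
  estimate.\<close>

lemma integral_uniform_sphere_inner2:
  fixes a w :: "'a::euclidean_space"
  shows "(\<integral>u. (a \<bullet> u) * (u \<bullet> w) \<partial>uniform_sphere) = (a \<bullet> w) / DIM('a)"
proof -
  interpret prob_space "uniform_sphere :: 'a measure" by (rule prob_space_uniform_sphere)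
  define Q where "Q b c = (\<integral>u. (b \<bullet> u) * (u \<bullet> c) \<partial>(uniform_sphere :: 'a measure))" for b c
  have off: "Q b c = 0" if bc: "b \<in> Basis" "c \<in> Basis" "b \<noteq> c" for b c
  proof -
    let ?F = "\<lambda>x. x - (2 * (x \<bullet> b)) *\<^sub>R b"
    have "(\<integral>u. (b \<bullet> ?F u) * (?F u \<bullet> c) \<partial>uniform_sphere) = Q b c"
      unfolding Q_def by (rule integral_uniform_sphere_isometry[OF linear_norm_flip[OF bc(1)] lborel_distr_flip[OF bc(1)]]) simp
    moreover have "(b \<bullet> ?F u) * (?F u \<bullet> c) = - ((b \<bullet> u) * (u \<bullet> c))" for u
      using bc by (simp add: inner_diff_left inner_diff_right inner_Basis inner_commute)
    ultimately show ?thesis by (simp add: Q_def)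
  qed
  have diag: "Q b b = Q c c" if bc: "b \<in> Basis" "c \<in> Basis" for b c
  proof (cases "b = c")
    case False
    let ?F = "\<lambda>x. x + (x \<bullet> c - x \<bullet> b) *\<^sub>R (b - c)"
    have lin: "linear ?F" by (auto intro!: linearI simp: algebra_simps)
    have nrm: "norm (?F x) = norm x" for x
      using bc False by (simp add: norm_eq inner_diff_left inner_diff_right inner_add_left inner_add_right
          inner_Basis inner_commute algebra_simps)
    have "(\<integral>u. (b \<bullet> ?F u) * (?F u \<bullet> b) \<partial>uniform_sphere) = Q b b"
      unfolding Q_def by (rule integral_uniform_sphere_isometry[OF lin nrm lborel_distr_swap[OF bc]]) simp
    moreover have "b \<bullet> ?F u = c \<bullet> u" "?F u \<bullet> b = u \<bullet> c" for u
      using bc False by (simp_all add: inner_diff_left inner_diff_right inner_add_left inner_add_right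
          inner_Basis inner_commute)
    ultimately show ?thesis by (simp add: Q_def)
  qed simp
  have tr: "(\<Sum>b\<in>Basis. Q b b) = 1"
  proof -
    have "(\<Sum>b\<in>Basis. Q b b) = (\<integral>u. (\<Sum>b\<in>Basis. (b \<bullet> u) * (u \<bullet> b)) \<partial>(uniform_sphere :: 'a measure))"
      unfolding Q_def by (subst Bochner_Integration.integral_sum) (auto intro: integrable_uniform_sphere_inner2)
    also have "\<dots> = (\<integral>u. 1 \<partial>(uniform_sphere :: 'a measure))"
    proof (rule Bochner_Integration.integral_cong)
      fix u :: 'a assume "u \<in> space uniform_sphere"
      then have "u \<bullet> u = 1" by (simp add: space_uniform_sphere norm_eq_1)
      then show "(\<Sum>b\<in>Basis. (b \<bullet> u) * (u \<bullet> b)) = 1" by (subst (asm) euclidean_inner) (simp add: inner_commute)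
    qed simp
    finally show ?thesis by (simp add: prob_space)
  qed
  have diag': "Q b b = 1 / DIM('a)" if "b \<in> Basis" for b
  proof -
    have "(\<Sum>c\<in>(Basis::'a set). Q c c) = (\<Sum>c\<in>(Basis::'a set). Q b b)" by (intro sum.cong refl diag that)
    then show ?thesis using tr by (simp add: field_simps)
  qed
  have "(\<integral>u. (a \<bullet> u) * (u \<bullet> w) \<partial>uniform_sphere)
      = (\<integral>u. (\<Sum>b\<in>Basis. \<Sum>c\<in>Basis. (a \<bullet> b) * (w \<bullet> c) * ((b \<bullet> u) * (u \<bullet> c))) \<partial>uniform_sphere)"
    by (subst euclidean_inner[of a], subst euclidean_inner[of _ w])
      (simp add: sum_product algebra_simps inner_commute)
  also have "\<dots> = (\<Sum>b\<in>Basis. \<Sum>c\<in>Basis. (a \<bullet> b) * (w \<bullet> c) * Q b c)"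
    unfolding Q_def
    by (simp add: Bochner_Integration.integral_sum integrable_uniform_sphere_inner2)
  also have "\<dots> = (\<Sum>b\<in>Basis. \<Sum>c\<in>Basis. if b = c then (a \<bullet> b) * (w \<bullet> b) / DIM('a) else 0)"
    by (intro sum.cong refl) (auto simp: off diag')
  also have "\<dots> = (a \<bullet> w) / DIM('a)"
    by (subst euclidean_inner[of a]) (simp add: sum_divide_distrib)
  finally show ?thesis .
qed

section \<open>Shrunk sets and smooth strongly monotone games\<close>

lemma shrunk_set_subset: "shrunk_set r \<delta> S \<subseteq> S"
  by (auto simp: shrunk_set_def)

lemma closed_shrunk_set: "closed S \<Longrightarrow> closed (shrunk_set r \<delta> S)"
proof -
  assume S: "closed S"
  have "shrunk_set r \<delta> S = S \<inter> (\<lambda>x. (1 / (1 - \<delta> / r)) *\<^sub>R x) -` S"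
    by (auto simp: shrunk_set_def)
  moreover have "closed ((\<lambda>x. (1 / (1 - \<delta> / r)) *\<^sub>R x) -` S)"
    using S by (intro closed_vimage) (auto intro!: continuous_intros)
  ultimately show ?thesis using S by (simp add: closed_Int)
qed

lemma convex_shrunk_set:
  fixes S :: "'a::euclidean_space set"
  assumes "convex S"
  shows "convex (shrunk_set r \<delta> S)"
proof -
  have "shrunk_set r \<delta> S = S \<inter> (\<lambda>x. (1 / (1 - \<delta> / r)) *\<^sub>R x) -` S"
    by (auto simp: shrunk_set_def)
  moreover have "linear (\<lambda>x::'a. (1 / (1 - \<delta> / r)) *\<^sub>R x)"
    by (rule linear_compose_scale_right[OF linear_ident])
  ultimately show ?thesis
    using assms convex_linear_vimage convex_Int by metis
qed

lemma scaleR_in_shrunk_set: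
  fixes S :: "'a::euclidean_space set"
  assumes "convex S" "0 \<in> S" "0 \<le> \<delta>" "\<delta> < r" "y \<in> S"
  shows "(1 - \<delta> / r) *\<^sub>R y \<in> shrunk_set r \<delta> S"
proof -
  have \<kappa>: "0 < 1 - \<delta> / r" "1 - \<delta> / r \<le> 1" using assms by (auto simp: field_simps)
  have "(1 - \<delta> / r) *\<^sub>R y + (1 - (1 - \<delta> / r)) *\<^sub>R 0 \<in> S"
    using assms \<kappa> by (intro convexD) auto
  then show ?thesis using \<kappa> assms by (simp add: shrunk_set_def)
qed

text \<open>If \<open>a\<close> and \<open>b\<close> are the shrink factors of
  \<open>\<delta>'\<close> and \<open>\<delta>\<close>, then \<open>x / b\<close> lies on the
  segment from 0 to \<open>x / a\<close>. This links episodes: an iterate is projected with one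
  radius and perturbed with the next, smaller one.\<close>

lemma shrunk_set_antimono:
  fixes S :: "'a::euclidean_space set"
  assumes "convex S" "0 \<in> S" "0 \<le> \<delta>" "\<delta> \<le> \<delta>'" "\<delta>' < r"
  shows "shrunk_set r \<delta>' S \<subseteq> shrunk_set r \<delta> S"
proof
  fix x assume x: "x \<in> shrunk_set r \<delta>' S"
  have r: "0 < r" using assms by linarith
  define a b where "a = 1 - \<delta>' / r" and "b = 1 - \<delta> / r"
  have ab: "0 < a" "a \<le> b" "0 < b"
    using assms r by (auto simp: a_def b_def field_simps)
  have "(a / b) *\<^sub>R ((1 / a) *\<^sub>R x) + (1 - a / b) *\<^sub>R 0 \<in> S"
    using assms ab x by (intro convexD) (auto simp: shrunk_set_def a_def field_simps)
  then show "x \<in> shrunk_set r \<delta> S"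
    using x ab by (simp add: shrunk_set_def b_def)
qed

lemma shrunk_set_perturb:
  fixes S :: "'a::euclidean_space set"
  assumes "convex S" "cball 0 r \<subseteq> S" "0 \<le> \<delta>" "\<delta> < r" "x \<in> shrunk_set r \<delta> S" "norm u \<le> 1"
  shows "x + \<delta> *\<^sub>R u \<in> S"
proof -
  have r: "0 < r" using assms by linarith
  define a where "a = 1 - \<delta> / r"
  have a: "0 < a" "a \<le> 1" "(1 - a) * r = \<delta>" using assms r by (auto simp: a_def field_simps)
  have "r *\<^sub>R u \<in> S" using assms r by (intro subsetD[OF assms(2)]) (auto simp: mult_left_le)
  then have "a *\<^sub>R ((1 / a) *\<^sub>R x) + (1 - a) *\<^sub>R (r *\<^sub>R u) \<in> S"
    using assms a by (intro convexD) (auto simp: shrunk_set_def a_def)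
  then show ?thesis using a by simp
qed

lemma norm_closest_point_le:
  assumes "convex S" "closed S" "p \<in> S"
  shows "norm (closest_point S a - p) \<le> norm (a - p)"
proof -
  have "S \<noteq> {}" using assms(3) by blast
  from closest_point_lipschitz[OF assms(1,2) this, of a p] show ?thesis
    by (simp add: closest_point_self[OF assms(3)] dist_norm)
qed

section \<open>Distances between joint actions\<close>

lemma joint_dist_upd:
  assumes "i \<in> {1..N}"
  shows "joint_dist N (x(i := y)) (x(i := z)) = norm (y - z)"
proof -
  have "(\<Sum>j=1..N. (norm ((x(i := y)) j - (x(i := z)) j))\<^sup>2) = (\<Sum>j=1..N. if j = i then (norm (y - z))\<^sup>2 else 0)"
    by (rule sum.cong) auto
  also have "\<dots> = (norm (y - z))\<^sup>2" using assms by simp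
  finally show ?thesis by (simp add: joint_dist_def L2_set_def)
qed

lemma power2_joint_dist: "(joint_dist N x y)\<^sup>2 = (\<Sum>i=1..N. (norm (x i - y i))\<^sup>2)"
  by (simp add: joint_dist_def L2_set_def sum_nonneg)

lemma sum_first_agents:
  fixes a b :: real
  assumes "Nz \<le> N"
  shows "(\<Sum>i=1..N. if i \<le> Nz then a else b) = real Nz * a + (real N - real Nz) * b"
proof -
  have "{1..N} \<inter> {i. i \<le> Nz} = {1..Nz}" "{1..N} \<inter> - {i. i \<le> Nz} = {Suc Nz..N}" using assms by auto
  then show ?thesis using assms by (simp add: sum.If_cases of_nat_diff)
qed

lemma joint_dist_played:
  assumes "Nz \<le> N" "0 \<le> \<delta>" "\<And>i. i \<in> {1..Nz} \<Longrightarrow> norm (u i) \<le> 1"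
  shows "joint_dist N (played Nz \<delta> u x) x \<le> \<delta> * sqrt (real Nz)"
proof -
  have "(\<Sum>i=1..N. (norm (played Nz \<delta> u x i - x i))\<^sup>2) \<le> (\<Sum>i=1..N. if i \<le> Nz then \<delta>\<^sup>2 else 0)"
  proof (rule sum_mono)
    fix i assume "i \<in> {1..N}"
    then show "(norm (played Nz \<delta> u x i - x i))\<^sup>2 \<le> (if i \<le> Nz then \<delta>\<^sup>2 else 0)"
      using assms(2) assms(3)[of i]
      by (auto simp: played_def power_mult_distrib intro!: mult_left_le power_le_one)
  qed
  also have "\<dots> = (\<delta> * sqrt (real Nz))\<^sup>2"
    unfolding sum_first_agents[OF assms(1)] by (simp add: power_mult_distrib)
  finally show ?thesis
    using assms(2) unfolding joint_dist_def L2_set_def by (intro real_le_lsqrt) (auto intro: sum_nonneg)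
qed

section \<open>Gradient bounds and the variational inequality at the equilibrium\<close>

locale smooth_monotone_game =
  fixes N :: nat and X :: "nat \<Rightarrow> 'a::euclidean_space set" and C :: "nat \<Rightarrow> (nat \<Rightarrow> 'a) \<Rightarrow> real"
    and G :: "nat \<Rightarrow> (nat \<Rightarrow> 'a) \<Rightarrow> 'a" and m r D U L0 L1 :: real and xs :: "nat \<Rightarrow> 'a"
  assumes pos: "m > 0" "r > 0" "D > 0" "U > 0" "L0 > 0" "L1 > 0"
    and X_closed: "\<And>i. i \<in> {1..N} \<Longrightarrow> closed (X i)"
    and X_convex: "\<And>i. i \<in> {1..N} \<Longrightarrow> convex (X i)"
    and X_cball: "\<And>i. i \<in> {1..N} \<Longrightarrow> cball 0 r \<subseteq> X i"
    and X_bounded: "\<And>i. i \<in> {1..N} \<Longrightarrow> bounded (X i)"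
    and X_diameter: "\<And>i. i \<in> {1..N} \<Longrightarrow> diameter (X i) \<le> D"
    and gradient: "is_own_gradient N X C G"
    and monotone: "strongly_monotone N X G m"
    and C_bound: "\<And>i x. i \<in> {1..N} \<Longrightarrow> x \<in> joint_actions N X \<Longrightarrow> \<bar>C i x\<bar> \<le> U"
    and C_lipschitz: "\<And>i x y. i \<in> {1..N} \<Longrightarrow> x \<in> joint_actions N X \<Longrightarrow> y \<in> joint_actions N X
      \<Longrightarrow> \<bar>C i x - C i y\<bar> \<le> L0 * joint_dist N x y"
    and G_lipschitz: "\<And>i x y. i \<in> {1..N} \<Longrightarrow> x \<in> joint_actions N X \<Longrightarrow> y \<in> joint_actions N X
      \<Longrightarrow> norm (G i x - G i y) \<le> L1 * joint_dist N x y"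
    and nash: "nash_equilibrium N X C xs"
begin

lemma X_0: "i \<in> {1..N} \<Longrightarrow> 0 \<in> X i"
  using X_cball[of i] pos by auto

lemma X_dist: "i \<in> {1..N} \<Longrightarrow> a \<in> X i \<Longrightarrow> b \<in> X i \<Longrightarrow> norm (a - b) \<le> D"
  using diameter_bounded_bound[OF X_bounded, of i a b] X_diameter[of i] by (simp add: dist_norm)

lemma X_norm: "i \<in> {1..N} \<Longrightarrow> a \<in> X i \<Longrightarrow> norm a \<le> D"
  using X_dist[of i a 0] X_0 by simp

lemma xs_joint: "xs \<in> joint_actions N X"
  using nash by (simp add: nash_equilibrium_def)

lemma joint_actions_nth: "x \<in> joint_actions N X \<Longrightarrow> i \<in> {1..N} \<Longrightarrow> x i \<in> X i"
  unfolding joint_actions_def by (rule PiE_mem)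

lemma joint_actions_upd:
  "x \<in> joint_actions N X \<Longrightarrow> i \<in> {1..N} \<Longrightarrow> y \<in> X i \<Longrightarrow> x(i := y) \<in> joint_actions N X"
  unfolding joint_actions_def by (auto simp: PiE_iff extensional_def)

lemma own_derivative:
  assumes "i \<in> {1..N}" "x \<in> joint_actions N X" "y \<in> X i"
  shows "((\<lambda>z. C i (x(i := z))) has_derivative (\<lambda>h. G i (x(i := y)) \<bullet> h)) (at y within X i)"
  using gradient[unfolded is_own_gradient_def, rule_format, OF assms(1) joint_actions_upd[OF assms(2,1,3)]]
  by simp

text \<open>The mean value inequality is applied to the cost minus its linear part, whose derivative
  on the segment is at most \<open>L1 * norm (y - x i)\<close>. This yields the constant
  \<open>L1\<close>, without the sharper factor 1/2.\<close>

lemma cost_taylor: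
  assumes i: "i \<in> {1..N}" and x: "x \<in> joint_actions N X" and y: "y \<in> X i"
  shows "\<bar>C i (x(i := y)) - C i x - G i x \<bullet> (y - x i)\<bar> \<le> L1 * (norm (y - x i))\<^sup>2"
proof -
  let ?S = "closed_segment (x i) y" and ?F = "\<lambda>z. C i (x(i := z)) - G i x \<bullet> z"
  have S: "?S \<subseteq> X i"
    using X_convex[OF i] joint_actions_nth[OF x i] y by (simp add: closed_segment_subset)
  have "norm (?F y - ?F (x i)) \<le> (L1 * norm (y - x i)) * norm (y - x i)"
  proof (rule differentiable_bound[where S = ?S and f' = "\<lambda>z h. (G i (x(i := z)) - G i x) \<bullet> h"])
    fix z assume z: "z \<in> ?S"
    show "(?F has_derivative (\<lambda>h. (G i (x(i := z)) - G i x) \<bullet> h)) (at z within ?S)"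
      using has_derivative_subset[OF own_derivative[OF i x] S, of z] z S
      by (auto intro!: derivative_eq_intros simp: inner_diff_left)
    have "norm (G i (x(i := z)) - G i x) \<le> L1 * joint_dist N (x(i := z)) (x(i := x i))"
      using G_lipschitz[OF i joint_actions_upd[OF x i] x, of z] z S by auto
    also have "\<dots> = L1 * norm (z - x i)" by (simp only: joint_dist_upd[OF i])
    also have "\<dots> \<le> L1 * norm (y - x i)"
      using segment_bound(1)[OF z] pos by (intro mult_left_mono) (auto simp: norm_minus_commute)
    finally have Gz: "norm (G i (x(i := z)) - G i x) \<le> L1 * norm (y - x i)" .
    show "onorm (\<lambda>h. (G i (x(i := z)) - G i x) \<bullet> h) \<le> L1 * norm (y - x i)"
    proof (rule onorm_le)
      fix h
      show "norm ((G i (x(i := z)) - G i x) \<bullet> h) \<le> L1 * norm (y - x i) * norm h"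
        unfolding real_norm_def
        by (rule order_trans[OF Cauchy_Schwarz_ineq2 mult_right_mono[OF Gz norm_ge_zero]])
    qed
  qed auto
  then show ?thesis by (simp add: inner_diff_right power2_eq_square algebra_simps)
qed

text \<open>\<open>L0 + L1 * D\<close> bounds the own gradient where the own action is 0; another
  \<open>L1 * D\<close> covers the move to an arbitrary own action.\<close>

definition grad_bound :: real where "grad_bound = L0 + 2 * L1 * D"

lemma grad_bound_pos: "0 < grad_bound"
  using pos by (simp add: grad_bound_def add_pos_pos)

text \<open>Bias per agent and per unit of \<open>\<delta> * sqrt Nz\<close>: \<open>L1\<close>
  stems from the simultaneous perturbations, \<open>DIM('a) * L1\<close> from the Taylor remainder
  of the one-point estimate, and \<open>grad_bound / r\<close> from testing against the shrunk
  equilibrium. The factor \<open>D\<close> bounds the vectors in the inner products.\<close>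

definition drift_const :: real where
  "drift_const = D * (L1 + real DIM('a) * L1 + grad_bound / r)"

lemma drift_const_pos: "0 < drift_const"
  using pos grad_bound_pos by (simp add: drift_const_def add_pos_pos)

text \<open>At a boundary action the gradient direction may be infeasible, so the bound is first
  obtained at own action 0, where a step of length \<open>r\<close> along the gradient stays in
  \<open>X i\<close>: Taylor against the \<open>L0\<close> bound gives \<open>L0 + L1 * r\<close>.
  Lipschitz continuity of the gradient carries it to all of \<open>X i\<close>.\<close>

lemma norm_G_le:
  assumes i: "i \<in> {1..N}" and x: "x \<in> joint_actions N X"
  shows "norm (G i x) \<le> grad_bound"
proof -
  let ?z = "x(i := 0)" and ?h = "r *\<^sub>R sgn (G i (x(i := 0)))"
  have z: "?z \<in> joint_actions N X" using joint_actions_upd[OF x i] X_0[OF i] .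
  have rD: "r \<le> D"
  proof -
    obtain b :: 'a where b: "b \<in> Basis" using nonempty_Basis by blast
    then have "r *\<^sub>R b \<in> X i" using pos by (intro subsetD[OF X_cball[OF i]]) auto
    from X_norm[OF i this] show ?thesis using b pos by simp
  qed
  have nh: "norm ?h \<le> r" using pos by (simp add: norm_sgn)
  have h: "?h \<in> X i" using nh by (intro subsetD[OF X_cball[OF i]]) auto
  have "r * norm (G i ?z) = G i ?z \<bullet> ?h"
    by (simp add: sgn_div_norm power2_norm_eq_inner[symmetric] power2_eq_square field_simps)
  also have "\<dots> \<le> \<bar>C i (?z(i := ?h)) - C i (?z(i := 0))\<bar> + L1 * (norm ?h)\<^sup>2"
    using cost_taylor[OF i z h] by simp
  also have "\<dots> \<le> L0 * norm ?h + L1 * (norm ?h)\<^sup>2"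
    using C_lipschitz[OF i joint_actions_upd[OF z i h] joint_actions_upd[OF z i X_0[OF i]]]
      joint_dist_upd[OF i, of ?z ?h 0] by simp
  also have "\<dots> \<le> L0 * r + L1 * r\<^sup>2"
    using nh pos by (intro add_mono mult_left_mono power_mono) auto
  finally have "r * norm (G i ?z) \<le> r * (L0 + L1 * r)" by (simp add: algebra_simps power2_eq_square)
  then have "norm (G i ?z) \<le> L0 + L1 * r" using pos by simp
  also have "\<dots> \<le> L0 + L1 * D" using rD pos by simp
  finally have *: "norm (G i ?z) \<le> L0 + L1 * D" .
  have "norm (G i (x(i := x i)) - G i ?z) \<le> L1 * norm (x i - 0)"
    using G_lipschitz[OF i _ z, of "x(i := x i)"] x joint_dist_upd[OF i, of x "x i" 0] by auto
  also have "\<dots> \<le> L1 * D" using X_norm[OF i joint_actions_nth[OF x i]] pos by simp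
  finally have "norm (G i x - G i ?z) \<le> L1 * D" by simp
  then show ?thesis
    using * norm_triangle_sub[of "G i x" "G i ?z"] by (simp add: grad_bound_def)
qed

text \<open>A step of fraction \<open>s\<close> towards \<open>y\<close> changes the own cost by at
  most \<open>s * (s * q - c)\<close>, where \<open>- c\<close> is the inner product; if
  \<open>c\<close> were positive, a small \<open>s\<close> would contradict optimality.\<close>

lemma nash_variational:
  assumes i: "i \<in> {1..N}" and y: "y \<in> X i"
  shows "0 \<le> G i xs \<bullet> (y - xs i)"
proof (rule ccontr)
  define c where "c = - (G i xs \<bullet> (y - xs i))"
  define q where "q = L1 * (norm (y - xs i))\<^sup>2"
  \<comment> \<open>Chosen so that \<open>s \<le> 1\<close>, which keeps the step feasible, and
    \<open>s * q < c\<close>.\<close>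
  define s where "s = c / (c + q + 1)"
  assume "\<not> ?thesis"
  then have c: "0 < c" by (simp add: c_def)
  have q: "0 \<le> q" using pos by (simp add: q_def)
  have s: "0 < s" "s \<le> 1" using c q by (auto simp: s_def)
  let ?y = "xs i + s *\<^sub>R (y - xs i)"
  have "?y = (1 - s) *\<^sub>R xs i + s *\<^sub>R y" by (simp add: algebra_simps)
  then have yX: "?y \<in> X i"
    using convexD[OF X_convex[OF i] joint_actions_nth[OF xs_joint i] y, of "1 - s" s] s by simp
  have "C i xs \<le> C i (xs(i := ?y))" using nash i yX by (auto simp: nash_equilibrium_def)
  then have "0 \<le> G i xs \<bullet> (s *\<^sub>R (y - xs i)) + L1 * (norm (s *\<^sub>R (y - xs i)))\<^sup>2"
    using cost_taylor[OF i xs_joint yX] by simp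
  also have "\<dots> = s * (s * q - c)"
    unfolding c_def q_def inner_scaleR_right norm_scaleR power_mult_distrib power2_abs
    by (simp add: power2_eq_square algebra_simps)
  finally have "c \<le> s * q" using s by (simp add: zero_le_mult_iff)
  then have "c * (c + q + 1) \<le> c * q" using c q by (simp add: s_def field_simps)
  moreover have "c * q < c * (c + q + 1)" using c q by (intro mult_strict_left_mono) auto
  ultimately show False by linarith
qed

text \<open>Strong monotonicity is used against the equilibrium only; the variational inequality
  then allows the gradient at the equilibrium to be dropped.\<close>

lemma monotone_nash:
  assumes x: "x \<in> joint_actions N X"
  shows "m * (joint_dist N x xs)\<^sup>2 \<le> (\<Sum>i=1..N. G i x \<bullet> (x i - xs i))"
proof -
  have "m * (joint_dist N x xs)\<^sup>2 \<le> (\<Sum>i=1..N. (G i x - G i xs) \<bullet> (x i - xs i))"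
    using monotone x xs_joint by (simp add: strongly_monotone_def)
  also have "\<dots> \<le> (\<Sum>i=1..N. G i x \<bullet> (x i - xs i))"
    using nash_variational joint_actions_nth[OF x]
    by (intro sum_mono) (simp add: inner_diff_left)
  finally show ?thesis .
qed

end

section \<open>One episode\<close>

text \<open>Difference of squares. It prices a change of reference point: moving the reference costs
  at most \<open>2 * D\<close> times its displacement in squared distance.\<close>

lemma power2_norm_diff_le:
  fixes a b :: "'a::real_normed_vector"
  assumes "norm a \<le> D" "norm b \<le> D"
  shows "(norm a)\<^sup>2 \<le> (norm b)\<^sup>2 + 2 * D * norm (a - b)"
proof -
  have D: "0 \<le> D" using norm_ge_zero[of a] assms(1) by linarith
  have "(norm a)\<^sup>2 - (norm b)\<^sup>2 = (norm a + norm b) * (norm a - norm b)"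
    by (simp add: power2_eq_square algebra_simps)
  also have "\<dots> \<le> (2 * D) * norm (a - b)"
  proof (cases "norm a \<le> norm b")
    case True
    then have "(norm a + norm b) * (norm a - norm b) \<le> 0" by (simp add: mult_nonneg_nonpos)
    also have "0 \<le> (2 * D) * norm (a - b)" using D by simp
    finally show ?thesis .
  next
    case False
    show ?thesis
      by (rule mult_mono) (use norm_triangle_ineq2[of a b] assms D False in auto)
  qed
  finally show ?thesis by simp
qed

lemma power2_norm_diff_scaleR:
  fixes w g :: "'a::real_inner"
  shows "(norm (w - c *\<^sub>R g))\<^sup>2 = (norm w)\<^sup>2 - 2 * c * (g \<bullet> w) + c\<^sup>2 * (norm g)\<^sup>2"
  unfolding power2_norm_eq_inner inner_diff_left inner_diff_right inner_scaleR_left inner_scaleR_right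
  by (simp add: inner_commute[of w g] power2_eq_square algebra_simps)

text \<open>One episode with its radius frozen. Positivity and \<open>\<delta> < r\<close> are
  conditional on the presence of zeroth-order agents because the prescribed radius is 0 when
  \<open>Nz = 0\<close>.\<close>

locale asym_round = smooth_monotone_game N X C G m r D U L0 L1 xs
  for N :: nat and X :: "nat \<Rightarrow> 'a::euclidean_space set" and C :: "nat \<Rightarrow> (nat \<Rightarrow> 'a) \<Rightarrow> real"
    and G :: "nat \<Rightarrow> (nat \<Rightarrow> 'a) \<Rightarrow> 'a" and m r D U L0 L1 :: real and xs :: "nat \<Rightarrow> 'a" +
  fixes Nz :: nat and \<delta> :: real
  assumes Nz_le: "Nz \<le> N" and \<delta>_nonneg: "0 \<le> \<delta>"
    and \<delta>_pos: "1 \<le> Nz \<Longrightarrow> 0 < \<delta>" and \<delta>_less: "1 \<le> Nz \<Longrightarrow> \<delta> < r"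
begin

definition target :: "nat \<Rightarrow> 'a" where
  "target i = (if i \<le> Nz then (1 - \<delta> / r) *\<^sub>R xs i else xs i)"

definition region :: "nat \<Rightarrow> 'a set" where
  "region i = (if i \<le> Nz then shrunk_set r \<delta> (X i) else X i)"

definition estimate :: "(nat \<Rightarrow> 'a) \<Rightarrow> (nat \<Rightarrow> 'a) \<Rightarrow> nat \<Rightarrow> 'a" where
  "estimate u x i =
    (if i \<le> Nz then (real DIM('a) / \<delta> * C i (played Nz \<delta> u x)) *\<^sub>R u i else G i (played Nz \<delta> u x))"

definition feasible :: "(nat \<Rightarrow> 'a) \<Rightarrow> bool" where
  "feasible x \<longleftrightarrow> x \<in> joint_actions N X \<and> (\<forall>i\<in>{1..N}. x i \<in> region i)"

definition unit_directions :: "(nat \<Rightarrow> 'a) \<Rightarrow> bool" where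
  "unit_directions u \<longleftrightarrow> (\<forall>i\<in>{1..Nz}. norm (u i) = 1)"

lemma asym_step_nth:
  "i \<in> {1..N} \<Longrightarrow> asym_step N Nz X C G r \<delta> \<eta> \<eta> u x i = closest_point (region i) (x i - \<eta> *\<^sub>R estimate u x i)"
  by (simp add: asym_step_def region_def estimate_def Let_def)

lemma region_subset: "region i \<subseteq> X i"
  using shrunk_set_subset by (auto simp: region_def)

lemma region_closed: "i \<in> {1..N} \<Longrightarrow> closed (region i)"
  by (simp add: region_def X_closed closed_shrunk_set)

lemma region_convex: "i \<in> {1..N} \<Longrightarrow> convex (region i)"
  by (simp add: region_def X_convex convex_shrunk_set)

lemma target_in_region: "i \<in> {1..N} \<Longrightarrow> target i \<in> region i"
  using scaleR_in_shrunk_set[OF X_convex X_0 \<delta>_nonneg \<delta>_less joint_actions_nth[OF xs_joint]]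
    joint_actions_nth[OF xs_joint]
  by (auto simp: target_def region_def)

lemma feasible_joint: "feasible x \<Longrightarrow> x \<in> joint_actions N X"
  by (simp add: feasible_def)

lemma feasible_target_dist:
  assumes "feasible x" "i \<in> {1..N}"
  shows "norm (x i - target i) \<le> D"
  using X_dist[OF assms(2) joint_actions_nth[OF feasible_joint[OF assms(1)] assms(2)]]
    region_subset[of i] target_in_region[OF assms(2)] by blast

lemma played_joint:
  assumes x: "feasible x" and u: "\<And>i. i \<in> {1..Nz} \<Longrightarrow> norm (u i) \<le> 1"
  shows "played Nz \<delta> u x \<in> joint_actions N X"
proof -
  have "x i + \<delta> *\<^sub>R u i \<in> X i" if i: "i \<in> {1..Nz}" for i
  proof -
    have iN: "i \<in> {1..N}" using i Nz_le by auto
    have "x i \<in> shrunk_set r \<delta> (X i)" using x i bspec[OF conjunct2[OF x[unfolded feasible_def]] iN] by (simp add: region_def)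
    then show ?thesis
      using shrunk_set_perturb[OF X_convex[OF iN] X_cball[OF iN] \<delta>_nonneg \<delta>_less _ u[OF i]] i by auto
  qed
  then show ?thesis
    using feasible_joint[OF x] Nz_le unfolding joint_actions_def PiE_iff extensional_def
    by (auto simp: played_def)
qed

lemma unit_directions_le: "unit_directions u \<Longrightarrow> i \<in> {1..Nz} \<Longrightarrow> norm (u i) \<le> 1"
  by (simp add: unit_directions_def)

lemma asym_step_in_region: "i \<in> {1..N} \<Longrightarrow> asym_step N Nz X C G r \<delta> \<eta> \<eta> u x i \<in> region i"
  using closest_point_in_set[OF region_closed] target_in_region by (force simp: asym_step_nth)

text \<open>Each block is the output of a projection onto a nonempty closed set, whatever
  \<open>u\<close> and \<open>x\<close> are. Feasibility of the iterates therefore holds at every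
  sample point, not merely almost surely.\<close>

lemma asym_step_feasible: "feasible (asym_step N Nz X C G r \<delta> \<eta> \<eta> u x)"
proof -
  have "asym_step N Nz X C G r \<delta> \<eta> \<eta> u x i \<in> region i" if "i \<in> {1..N}" for i
    using asym_step_in_region[OF that] .
  moreover have "asym_step N Nz X C G r \<delta> \<eta> \<eta> u x \<in> extensional {1..N}"
    by (simp only: asym_step_def Let_def restrict_extensional)
  ultimately show ?thesis
    using region_subset unfolding feasible_def joint_actions_def PiE_iff by blast
qed

lemma norm_estimate_le:
  assumes "feasible x" "unit_directions u" "i \<in> {1..N}"
  shows "norm (estimate u x i) \<le> (if i \<le> Nz then real DIM('a) * U / \<delta> else grad_bound)"
proof -
  have p: "played Nz \<delta> u x \<in> joint_actions N X"
    using played_joint[OF assms(1) unit_directions_le[OF assms(2)]] by simp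
  have "real DIM('a) / \<delta> * \<bar>C i (played Nz \<delta> u x)\<bar> \<le> real DIM('a) / \<delta> * U"
    using C_bound[OF assms(3) p] \<delta>_nonneg by (intro mult_left_mono) auto
  then show ?thesis
    using norm_G_le[OF assms(3) p] assms(2,3) \<delta>_nonneg
    by (auto simp: estimate_def unit_directions_def abs_mult)
qed

text \<open>Projection brings no point farther from \<open>target i\<close>, since that point lies
  in \<open>region i\<close>; the rest expands the square and uses deterministic bounds on the
  estimates. The inequality is pathwise, and the cross term is what gets averaged later.\<close>

lemma asym_step_descent:
  assumes "feasible x" "unit_directions u"
  shows "(\<Sum>i=1..N. (norm (asym_step N Nz X C G r \<delta> \<eta> \<eta> u x i - target i))\<^sup>2)
    \<le> (\<Sum>i=1..N. (norm (x i - target i))\<^sup>2) - 2 * \<eta> * (\<Sum>i=1..N. estimate u x i \<bullet> (x i - target i))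
      + \<eta>\<^sup>2 * (real Nz * (real DIM('a) * U / \<delta>)\<^sup>2 + (real N - real Nz) * grad_bound\<^sup>2)"
proof -
  let ?b = "\<lambda>i. if i \<le> Nz then (real DIM('a) * U / \<delta>)\<^sup>2 else grad_bound\<^sup>2"
  have "(norm (asym_step N Nz X C G r \<delta> \<eta> \<eta> u x i - target i))\<^sup>2
    \<le> (norm (x i - target i))\<^sup>2 - 2 * \<eta> * (estimate u x i \<bullet> (x i - target i)) + \<eta>\<^sup>2 * ?b i"
    if i: "i \<in> {1..N}" for i
  proof -
    let ?g = "estimate u x i" and ?w = "x i - target i"
    have "(norm (asym_step N Nz X C G r \<delta> \<eta> \<eta> u x i - target i))\<^sup>2 \<le> (norm (x i - \<eta> *\<^sub>R ?g - target i))\<^sup>2"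
      unfolding asym_step_nth[OF i]
      by (intro power_mono norm_closest_point_le region_convex region_closed target_in_region i) auto
    also have "x i - \<eta> *\<^sub>R ?g - target i = ?w - \<eta> *\<^sub>R ?g" by simp
    also have "(norm (?w - \<eta> *\<^sub>R ?g))\<^sup>2 = (norm ?w)\<^sup>2 - 2 * \<eta> * (?g \<bullet> ?w) + \<eta>\<^sup>2 * (norm ?g)\<^sup>2"
      by (rule power2_norm_diff_scaleR)
    also have "(norm ?g)\<^sup>2 \<le> ?b i"
      using power_mono[OF norm_estimate_le[OF assms i] norm_ge_zero, of 2] by auto
    finally show ?thesis by (simp add: mult_left_mono)
  qed
  then have "(\<Sum>i=1..N. (norm (asym_step N Nz X C G r \<delta> \<eta> \<eta> u x i - target i))\<^sup>2)
    \<le> (\<Sum>i=1..N. (norm (x i - target i))\<^sup>2 - 2 * \<eta> * (estimate u x i \<bullet> (x i - target i)) + \<eta>\<^sup>2 * ?b i)"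
    by (rule sum_mono)
  also have "\<dots> = (\<Sum>i=1..N. (norm (x i - target i))\<^sup>2) - 2 * \<eta> * (\<Sum>i=1..N. estimate u x i \<bullet> (x i - target i))
      + \<eta>\<^sup>2 * (\<Sum>i=1..N. ?b i)"
    by (simp add: sum.distrib sum_subtractf sum_distrib_left)
  finally show ?thesis by (simp only: sum_first_agents[OF Nz_le])
qed

text \<open>The two profiles are at distance at most \<open>\<delta> * sqrt Nz\<close>. Norms at
  most 1 are allowed for the directions so that the bound also covers the profile in which agent
  \<open>i\<close> alone is unperturbed.\<close>

lemma perturbed_gradient_le:
  assumes x: "feasible x" and u: "\<And>i. i \<in> {1..Nz} \<Longrightarrow> norm (u i) \<le> 1" and i: "i \<in> {1..N}"
  shows "G i x \<bullet> (x i - target i) - L1 * D * (\<delta> * sqrt (real Nz)) \<le> G i (played Nz \<delta> u x) \<bullet> (x i - target i)"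
proof -
  let ?w = "x i - target i"
  have "(G i x - G i (played Nz \<delta> u x)) \<bullet> ?w \<le> norm (G i x - G i (played Nz \<delta> u x)) * norm ?w"
    by (rule norm_cauchy_schwarz)
  also have "\<dots> \<le> (L1 * (\<delta> * sqrt (real Nz))) * D"
  proof (rule mult_mono)
    have "norm (G i (played Nz \<delta> u x) - G i x) \<le> L1 * joint_dist N (played Nz \<delta> u x) x"
      using G_lipschitz[OF i played_joint[OF x u] feasible_joint[OF x]] by simp
    also have "\<dots> \<le> L1 * (\<delta> * sqrt (real Nz))"
      using joint_dist_played[OF Nz_le \<delta>_nonneg u] pos by (intro mult_left_mono) auto
    finally show "norm (G i x - G i (played Nz \<delta> u x)) \<le> L1 * (\<delta> * sqrt (real Nz))"
      by (simp add: norm_minus_commute)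
  qed (use feasible_target_dist[OF x i] pos \<delta>_nonneg in auto)
  finally show ?thesis by (simp add: inner_diff_left algebra_simps)
qed

text \<open>A first-order agent sees an exact gradient, though at the perturbed profile, so its bias
  bound holds for every draw without averaging.\<close>

lemma drift_first_order:
  assumes x: "feasible x" and u: "unit_directions u" and i: "i \<in> {1..N}" "Nz < i"
  shows "G i x \<bullet> (x i - xs i) - drift_const * (\<delta> * sqrt (real Nz)) \<le> estimate u x i \<bullet> (x i - target i)"
proof -
  have "L1 * D * (\<delta> * sqrt (real Nz)) \<le> drift_const * (\<delta> * sqrt (real Nz))"
    using pos \<delta>_nonneg grad_bound_pos
    by (intro mult_right_mono) (auto simp: drift_const_def algebra_simps intro!: add_nonneg_nonneg)
  moreover have "target i = xs i" using i by (simp add: target_def)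
  ultimately show ?thesis
    using perturbed_gradient_le[OF x _ i(1), of u] unit_directions_le[OF u] i(2) by (simp add: estimate_def)
qed

lemma played_upd: "i \<in> {1..Nz} \<Longrightarrow> played Nz \<delta> (u(i := v)) x = (played Nz \<delta> u x)(i := x i + \<delta> *\<^sub>R v)"
  by (auto simp: played_def)

text \<open>A second-order Taylor expansion of the cost in the own action turns the one-point estimate into
  the first two moments of the uniform direction, so that no divergence theorem is needed.\<close>

lemma drift_zeroth_order:
  assumes x: "feasible x" and u: "unit_directions u" and i: "i \<in> {1..Nz}"
  shows "integrable uniform_sphere (\<lambda>v. estimate (u(i := v)) x i \<bullet> (x i - target i))" (is ?I)
    and "G i x \<bullet> (x i - xs i) - drift_const * (\<delta> * sqrt (real Nz))
    \<le> (\<integral>v. estimate (u(i := v)) x i \<bullet> (x i - target i) \<partial>uniform_sphere)"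
proof -
  interpret S: prob_space "uniform_sphere :: 'a measure" by (rule prob_space_uniform_sphere)
  have iN: "i \<in> {1..N}" using i Nz_le by auto
  have Nz1: "1 \<le> Nz" using i by auto
  have \<delta>: "0 < \<delta>" "\<delta> < r" using \<delta>_pos \<delta>_less Nz1 by auto
  let ?d = "real DIM('a)" and ?w = "x i - target i"
  \<comment> \<open>Base point of the expansion: agent \<open>i\<close> is unperturbed while the
    other zeroth-order agents keep their frozen perturbations.\<close>
  define z where "z = played Nz \<delta> (u(i := 0)) x"
  let ?f = "\<lambda>v. C i (played Nz \<delta> (u(i := v)) x)"
  have le1: "norm ((u(i := v)) j) \<le> 1" if "norm v \<le> 1" "j \<in> {1..Nz}" for v j
    using u that by (auto simp: unit_directions_def)
  have pj: "played Nz \<delta> (u(i := v)) x \<in> joint_actions N X" if "norm v \<le> 1" for v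
    using played_joint[OF x, of "u(i := v)"] le1[OF that] by blast
  have zJ: "z \<in> joint_actions N X" and zi: "z i = x i"
    using pj[of 0] i by (simp_all add: z_def played_def)
  have pz: "played Nz \<delta> (u(i := v)) x = z(i := x i + \<delta> *\<^sub>R v)" for v
    using played_upd[OF i, of u] by (simp add: z_def)
  have w: "norm ?w \<le> D" by (rule feasible_target_dist[OF x iN])
  have taylor: "\<bar>?f v - C i z - \<delta> * (G i z \<bullet> v)\<bar> \<le> L1 * \<delta>\<^sup>2" if v: "norm v = 1" for v
  proof -
    have "x i + \<delta> *\<^sub>R v \<in> X i"
      using joint_actions_nth[OF pj iN, of v] v i by (simp add: played_def)
    from cost_taylor[OF iN zJ this] show ?thesis using v by (simp add: pz zi power_mult_distrib)
  qed
  \<comment> \<open>The cost is controlled on joint actions only. Along the sphere it is Lipschitz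
    in \<open>v\<close>, which suffices because the measure space is the sphere itself.\<close>
  have fm: "?f \<in> borel_measurable uniform_sphere"
  proof -
    have "(L0 * \<delta>)-lipschitz_on (sphere 0 1) ?f"
    proof (rule lipschitz_onI)
      fix v v' :: 'a assume "v \<in> sphere 0 1" "v' \<in> sphere 0 1"
      then have "\<bar>?f v - ?f v'\<bar> \<le> L0 * joint_dist N (played Nz \<delta> (u(i := v)) x) (played Nz \<delta> (u(i := v')) x)"
        by (intro C_lipschitz iN pj) auto
      also have "\<dots> = L0 * \<delta> * norm (v - v')"
        unfolding pz joint_dist_upd[OF iN] using \<delta> by (simp add: scaleR_diff_right[symmetric] del: scaleR_diff_right)
      finally show "dist (?f v) (?f v') \<le> L0 * \<delta> * dist v v'" by (simp add: dist_norm)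
    qed (use pos \<delta> in auto)
    from borel_measurable_continuous_on_restrict[OF lipschitz_on_continuous_on[OF this]]
    show ?thesis by (simp add: measurable_cong_sets[OF sets_uniform_sphere refl])
  qed
  have wm: "(\<lambda>v. v \<bullet> ?w) \<in> borel_measurable uniform_sphere"
    by (rule borel_measurable_uniform_sphere) simp
  have vw: "\<bar>v \<bullet> ?w\<bar> \<le> D" if "norm v = 1" for v
    using Cauchy_Schwarz_ineq2[of v ?w] that w by simp
  have est: "estimate (u(i := v)) x i \<bullet> ?w = ?d / \<delta> * ?f v * (v \<bullet> ?w)" for v
    using i by (simp add: estimate_def)
  have int1: "integrable uniform_sphere (\<lambda>v. v \<bullet> ?w)"
    using wm vw by (rule integrable_uniform_sphere_bounded)
  have int2: "integrable uniform_sphere (\<lambda>v. ?d / \<delta> * ?f v * (v \<bullet> ?w))"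
  proof (rule integrable_uniform_sphere_bounded)
    show "(\<lambda>v. ?d / \<delta> * ?f v * (v \<bullet> ?w)) \<in> borel_measurable uniform_sphere" using fm wm by measurable
    fix v :: 'a assume v: "norm v = 1"
    have "\<bar>?f v\<bar> * \<bar>v \<bullet> ?w\<bar> \<le> U * D"
      using C_bound[OF iN pj[of v]] vw[OF v] v pos by (intro mult_mono) auto
    then have "?d / \<delta> * (\<bar>?f v\<bar> * \<bar>v \<bullet> ?w\<bar>) \<le> ?d / \<delta> * (U * D)"
      using \<delta> by (intro mult_left_mono) auto
    then show "\<bar>?d / \<delta> * ?f v * (v \<bullet> ?w)\<bar> \<le> ?d / \<delta> * (U * D)"
      using \<delta> by (simp add: abs_mult mult.assoc)
  qed
  \<comment> \<open>The constant Taylor term has mean zero, the linear term averages to exactly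
    \<open>G i z \<bullet> ?w\<close>, and the remainder of order \<open>\<delta>\<^sup>2\<close>,
    multiplied by \<open>?d / \<delta>\<close>, costs a term of order
    \<open>\<delta>\<close>.\<close>
  have "G i z \<bullet> ?w - ?d * L1 * \<delta> * D
      = (\<integral>v. ?d / \<delta> * C i z * (v \<bullet> ?w) + ?d * ((G i z \<bullet> v) * (v \<bullet> ?w)) - ?d * L1 * \<delta> * D \<partial>uniform_sphere)"
    using int1 integrable_uniform_sphere_inner2[of "G i z" ?w]
    by (simp add: integral_uniform_sphere_inner integral_uniform_sphere_inner2 S.prob_space)
  also have "\<dots> \<le> (\<integral>v. ?d / \<delta> * ?f v * (v \<bullet> ?w) \<partial>uniform_sphere)"
  proof (rule integral_mono)
    fix v :: 'a assume "v \<in> space uniform_sphere"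
    then have v: "norm v = 1" by (simp add: space_uniform_sphere)
    define e where "e = ?f v - C i z - \<delta> * (G i z \<bullet> v)"
    have "\<bar>e * (v \<bullet> ?w)\<bar> \<le> L1 * \<delta>\<^sup>2 * D"
      unfolding abs_mult using taylor[OF v] vw[OF v] pos by (intro mult_mono) (auto simp: e_def)
    then have *: "?d / \<delta> * (- (L1 * \<delta>\<^sup>2 * D)) \<le> ?d / \<delta> * (e * (v \<bullet> ?w))"
      using \<delta> by (intro mult_left_mono) auto
    then show "?d / \<delta> * C i z * (v \<bullet> ?w) + ?d * ((G i z \<bullet> v) * (v \<bullet> ?w)) - ?d * L1 * \<delta> * D
        \<le> ?d / \<delta> * ?f v * (v \<bullet> ?w)"
    proof -
      have "?d / \<delta> * ?f v * (v \<bullet> ?w) = ?d / \<delta> * C i z * (v \<bullet> ?w) + ?d * ((G i z \<bullet> v) * (v \<bullet> ?w)) + ?d / \<delta> * (e * (v \<bullet> ?w))"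
        using \<delta> unfolding e_def by (simp add: left_diff_distrib right_diff_distrib del: inner_diff_right)
      moreover have "?d / \<delta> * (- (L1 * \<delta>\<^sup>2 * D)) = - (?d * L1 * \<delta> * D)"
        using \<delta> by (simp add: power2_eq_square)
      ultimately show ?thesis using * by linarith
    qed
  qed (use int1 int2 integrable_uniform_sphere_inner2[of "G i z" ?w] in auto)
  finally have main: "G i z \<bullet> ?w - ?d * L1 * \<delta> * D
      \<le> (\<integral>v. estimate (u(i := v)) x i \<bullet> ?w \<partial>uniform_sphere)" by (simp only: est)
  have pert: "G i x \<bullet> ?w - L1 * D * (\<delta> * sqrt (real Nz)) \<le> G i z \<bullet> ?w"
    unfolding z_def by (rule perturbed_gradient_le[OF x le1 iN]) auto
  have tgt: "x i - xs i = ?w - (\<delta> / r) *\<^sub>R xs i" using i by (simp add: target_def algebra_simps)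
  have "\<bar>G i x \<bullet> xs i\<bar> \<le> grad_bound * D"
    using Cauchy_Schwarz_ineq2[of "G i x" "xs i"] norm_G_le[OF iN feasible_joint[OF x]] grad_bound_pos
      mult_mono[OF norm_G_le[OF iN feasible_joint[OF x]] X_norm[OF iN joint_actions_nth[OF xs_joint iN]]]
    by auto
  then have "\<delta> / r * (- (grad_bound * D)) \<le> \<delta> / r * (G i x \<bullet> xs i)"
    using \<delta> pos by (intro mult_left_mono) auto
  then have shift: "G i x \<bullet> (x i - xs i) - \<delta> / r * (grad_bound * D) \<le> G i x \<bullet> ?w"
    unfolding tgt by (simp add: inner_diff_right)
  \<comment> \<open>As \<open>Nz\<close> is at least 1, errors of order \<open>\<delta>\<close> may
    be inflated by \<open>sqrt Nz\<close> to fit the common form of the bias.\<close>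
  have "(?d * L1 * D + grad_bound * D / r) * \<delta> \<le> (?d * L1 * D + grad_bound * D / r) * (\<delta> * sqrt (real Nz))"
    using pos grad_bound_pos \<delta> Nz1 by (intro mult_left_mono) auto
  then have "?d * L1 * \<delta> * D + L1 * D * (\<delta> * sqrt (real Nz)) + \<delta> / r * (grad_bound * D)
      \<le> drift_const * (\<delta> * sqrt (real Nz))"
    by (simp add: drift_const_def algebra_simps)
  then show "G i x \<bullet> (x i - xs i) - drift_const * (\<delta> * sqrt (real Nz))
      \<le> (\<integral>v. estimate (u(i := v)) x i \<bullet> ?w \<partial>uniform_sphere)"
    using main pert shift by linarith
  show ?I unfolding est by (rule int2)
qed

text \<open>Each of the \<open>Nz\<close> shrunk blocks of the reference is displaced by at most
  \<open>\<delta> * D / r\<close>. The first direction feeds strong monotonicity into the Lyapunov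
  function; the second returns to the true equilibrium at the end.\<close>

lemma target_dist_compare:
  assumes x: "feasible x"
  shows "(\<Sum>i=1..N. (norm (x i - target i))\<^sup>2) \<le> (joint_dist N x xs)\<^sup>2 + 2 * D\<^sup>2 / r * (real Nz * \<delta>)"
    and dist_le_target_dist:
      "(joint_dist N x xs)\<^sup>2 \<le> (\<Sum>i=1..N. (norm (x i - target i))\<^sup>2) + 2 * D\<^sup>2 / r * (real Nz * \<delta>)"
proof -
  let ?b = "\<lambda>i. if i \<le> Nz then 2 * D\<^sup>2 / r * \<delta> else 0"
  have le: "(norm (x i - target i))\<^sup>2 \<le> (norm (x i - xs i))\<^sup>2 + ?b i
      \<and> (norm (x i - xs i))\<^sup>2 \<le> (norm (x i - target i))\<^sup>2 + ?b i"
    if i: "i \<in> {1..N}" for i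
  proof (cases "i \<le> Nz")
    case True
    have xsX: "xs i \<in> X i" and xX: "x i \<in> X i"
      using joint_actions_nth[OF xs_joint i] joint_actions_nth[OF feasible_joint[OF x] i] by auto
    note bounds = feasible_target_dist[OF x i] X_dist[OF i xX xsX]
    have "x i - target i - (x i - xs i) = (\<delta> / r) *\<^sub>R xs i" using True by (simp add: target_def algebra_simps)
    then have "norm (x i - target i - (x i - xs i)) \<le> \<delta> / r * D"
      using X_norm[OF i xsX] \<delta>_nonneg pos by (simp add: mult_left_mono divide_right_mono)
    then have "2 * D * norm (x i - target i - (x i - xs i)) \<le> 2 * D * (\<delta> / r * D)"
      using pos by (intro mult_left_mono) auto
    also have "\<dots> = 2 * D\<^sup>2 / r * \<delta>" by (simp add: power2_eq_square)
    finally show ?thesis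
      using power2_norm_diff_le[OF bounds] power2_norm_diff_le[OF bounds(2,1)] True
      unfolding norm_minus_commute[of "x i - xs i" "x i - target i"] by simp
  qed (simp add: target_def)
  have "(\<Sum>i=1..N. ?b i) = 2 * D\<^sup>2 / r * (real Nz * \<delta>)"
    unfolding sum_first_agents[OF Nz_le] by simp
  then show "(\<Sum>i=1..N. (norm (x i - target i))\<^sup>2) \<le> (joint_dist N x xs)\<^sup>2 + 2 * D\<^sup>2 / r * (real Nz * \<delta>)"
    and "(joint_dist N x xs)\<^sup>2 \<le> (\<Sum>i=1..N. (norm (x i - target i))\<^sup>2) + 2 * D\<^sup>2 / r * (real Nz * \<delta>)"
    using sum_mono[of "{1..N}" _ "\<lambda>i. (norm (x i - xs i))\<^sup>2 + ?b i", OF conjunct1[OF le]]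
      sum_mono[of "{1..N}" _ "\<lambda>i. (norm (x i - target i))\<^sup>2 + ?b i", OF conjunct2[OF le]]
    unfolding power2_joint_dist sum.distrib by simp_all
qed

lemma sum_gradient_ge:
  assumes x: "feasible x"
  shows "m * (\<Sum>i=1..N. (norm (x i - target i))\<^sup>2) - m * (2 * D\<^sup>2 / r) * (real Nz * \<delta>)
    \<le> (\<Sum>i=1..N. G i x \<bullet> (x i - xs i))"
proof -
  have "m * (\<Sum>i=1..N. (norm (x i - target i))\<^sup>2) \<le> m * ((joint_dist N x xs)\<^sup>2 + 2 * D\<^sup>2 / r * (real Nz * \<delta>))"
    using target_dist_compare[OF x] pos by (intro mult_left_mono) auto
  then show ?thesis
    using monotone_nash[OF feasible_joint[OF x]] by (simp add: distrib_left)
qed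

end

section \<open>Rates\<close>

text \<open>Fubini with coordinate \<open>p\<close> innermost. It plays the role of conditioning on
  all other directions.\<close>

lemma integral_PiM_nonneg_coordinate:
  fixes f :: "('i \<Rightarrow> 'b) \<Rightarrow> real"
  assumes M: "prob_space M" and J: "finite J" "p \<in> J" and f: "integrable (\<Pi>\<^sub>M j\<in>J. M) f"
    and nonneg: "\<And>w. w \<in> space (\<Pi>\<^sub>M j\<in>J. M) \<Longrightarrow> 0 \<le> (\<integral>y. f (w(p := y)) \<partial>M)"
  shows "0 \<le> (\<integral>w. f w \<partial>(\<Pi>\<^sub>M j\<in>J. M))"
proof -
  interpret M: prob_space M by (rule M)
  interpret product_sigma_finite "\<lambda>_. M" by standard
  have J': "insert p (J - {p}) = J" using J by auto
  \<comment> \<open>An arbitrary value that completes a point on \<open>J - {p}\<close> to one on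
    \<open>J\<close>, so that \<open>nonneg\<close> applies; the update by \<open>y\<close>
    overwrites it.\<close>
  obtain y0 where y0: "y0 \<in> space M" using M.not_empty by blast
  have "0 \<le> (\<integral>x. (\<integral>y. f (x(p := y)) \<partial>M) \<partial>(\<Pi>\<^sub>M j\<in>J - {p}. M))"
  proof (rule integral_nonneg_AE, rule AE_I2)
    fix x assume x: "x \<in> space (\<Pi>\<^sub>M j\<in>J - {p}. M)"
    have "x(p := y0) \<in> space (\<Pi>\<^sub>M j\<in>J. M)"
      using x y0 J by (auto simp: space_PiM PiE_iff extensional_def)
    from nonneg[OF this] show "0 \<le> (\<integral>y. f (x(p := y)) \<partial>M)" by simp
  qed
  then show ?thesis
    using product_integral_insert[of "J - {p}" p f, unfolded J'] J(1) f by simp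
qed

section \<open>Power laws and the scalar recursion\<close>

lemma powr_minus_third: "x powr (-1/3) = 1 / x powr (1/3 :: real)"
  using powr_minus_divide[of x "1/3"] by simp

text \<open>A ratio at most 1 only grows when raised to the power 1/3.\<close>

lemma powr_minus_third_step:
  assumes "1 \<le> t"
  shows "real t / real (Suc t) * real t powr (-1/3) \<le> real (Suc t) powr (-1/3)"
proof -
  have "real t / real (Suc t) \<le> (real t / real (Suc t)) powr (1/3)"
    using powr_mono'[of "1/3" 1 "real t / real (Suc t)"] assms by simp
  also have "\<dots> = real t powr (1/3) * real (Suc t) powr (-1/3)"
    unfolding powr_minus_third by (simp add: powr_divide)
  finally have "real t / real (Suc t) * real t powr (-1/3)
      \<le> real t powr (1/3) * real (Suc t) powr (-1/3) * real t powr (-1/3)"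
    by (rule mult_right_mono) simp
  also have "\<dots> = real t powr (1/3 + -1/3) * real (Suc t) powr (-1/3)"
    by (simp only: powr_add mult_ac)
  also have "\<dots> = real (Suc t) powr (-1/3)" using assms by simp
  finally show ?thesis .
qed

text \<open>Contraction \<open>1 - 2 / t\<close> plus an error of at most \<open>K / t\<close>
  leaves the factor \<open>1 - 1 / t\<close>, which is below \<open>t / (t + 1)\<close>, the decay
  that \<open>slow\<close> permits.\<close>

lemma contraction_recursion:
  fixes E \<phi> :: "nat \<Rightarrow> real"
  assumes "0 \<le> c" "2 * c \<le> K"
    and E: "\<And>t. 0 \<le> E t" and \<phi>: "\<And>t. 1 \<le> t \<Longrightarrow> 0 \<le> \<phi> t"
    and base: "E 1 \<le> K * \<phi> 1"
    and rec: "\<And>t. 1 \<le> t \<Longrightarrow> Suc t \<le> T \<Longrightarrow> E (Suc t) \<le> (1 - 2 / real t) * E t + c / real t * \<phi> t"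
    and slow: "\<And>t. 1 \<le> t \<Longrightarrow> real t / real (Suc t) * \<phi> t \<le> \<phi> (Suc t)"
    and t: "1 \<le> t" "t \<le> T"
  shows "E t \<le> K * \<phi> t"
  using t
proof (induction t rule: dec_induct)
  case base
  then show ?case using assms by simp
next
  case (step t)
  have K: "0 \<le> K" "c \<le> K" using assms by auto
  have "E (Suc t) \<le> K * (real t / real (Suc t) * \<phi> t)"
  \<comment> \<open>Here \<open>1 - 2 / t\<close> is -1, so the induction hypothesis cannot be
    multiplied by it; nonnegativity of \<open>E\<close> discards the term instead. The factor
    \<open>t / (t + 1)\<close> is 1/2, which is why \<open>2 * c \<le> K\<close> is
    required.\<close>
  proof (cases "t = 1")
    case True
    have "E (Suc t) \<le> c * \<phi> 1" using rec[of t] E[of 1] step True by simp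
    also have "\<dots> \<le> (K / 2) * \<phi> 1" using assms \<phi>[of 1] by (intro mult_right_mono) auto
    finally show ?thesis using True by simp
  next
    case False
    then have t2: "2 \<le> real t" using step by simp
    have "E (Suc t) \<le> (1 - 2 / real t) * (K * \<phi> t) + c / real t * \<phi> t"
      using rec[of t] step t2 mult_left_mono[OF step.IH, of "1 - 2 / real t"] by simp
    also have "\<dots> \<le> (1 - 2 / real t) * (K * \<phi> t) + K / real t * \<phi> t"
      using K \<phi>[of t] step by (intro add_left_mono mult_right_mono divide_right_mono) auto
    also have "\<dots> = (1 - 1 / real t) * (K * \<phi> t)" using t2 by (simp add: field_simps)
    also have "\<dots> \<le> real t / real (Suc t) * (K * \<phi> t)"
      using K \<phi>[of t] step t2 by (intro mult_right_mono) (auto simp: field_simps)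
    finally show ?thesis by (simp add: mult_ac)
  qed
  also have "\<dots> \<le> K * \<phi> (Suc t)" using slow[of t] step K by (intro mult_left_mono) auto
  finally show ?case .
qed

section \<open>Exponent arithmetic for the rate and the radius\<close>

definition rate :: "nat \<Rightarrow> nat \<Rightarrow> nat \<Rightarrow> real" where
  "rate N Nz t = real Nz powr (2/3) * real N powr (2/3) * real t powr (-1/3) + (real N - real Nz) * real t powr (-1)"

definition radius :: "nat \<Rightarrow> nat \<Rightarrow> nat \<Rightarrow> real" where
  "radius N Nz t = real Nz powr (1/6) / (real N powr (1/3) * real t powr (1/3))"

lemma rate_nonneg: "Nz \<le> N \<Longrightarrow> 0 \<le> rate N Nz t"
  by (simp add: rate_def)

lemma rate_slow:
  assumes "Nz \<le> N" "1 \<le> t"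
  shows "real t / real (Suc t) * rate N Nz t \<le> rate N Nz (Suc t)"
proof -
  let ?A = "real Nz powr (2/3) * real N powr (2/3)" and ?F = "real N - real Nz"
  have "?A * (real t / real (Suc t) * real t powr (-1/3)) \<le> ?A * real (Suc t) powr (-1/3)"
    using powr_minus_third_step[OF assms(2)] by (intro mult_left_mono) auto
  moreover have "real t / real (Suc t) * (?F * real t powr (-1)) = ?F * real (Suc t) powr (-1)"
    using assms(2) by (simp add: powr_minus_divide)
  moreover have "real t / real (Suc t) * rate N Nz t = ?A * (real t / real (Suc t) * real t powr (-1/3))
      + real t / real (Suc t) * (?F * real t powr (-1))"
    unfolding rate_def by (simp add: distrib_left mult_ac)
  ultimately show ?thesis unfolding rate_def by linarith
qed

text \<open>Base case of the recursion, where the squared distance is at most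
  \<open>N * D\<^sup>2\<close>: the part \<open>Nz\<close> of \<open>N\<close> is at most
  \<open>Nz^(2/3) * N^(2/3)\<close>, and \<open>N - Nz\<close> is the other summand.\<close>

lemma agents_le_rate:
  assumes "Nz \<le> N"
  shows "real N \<le> rate N Nz 1"
proof (cases "Nz = 0")
  case False
  have "real Nz = real Nz powr (2/3 + 1/3)" using False by simp
  also have "\<dots> = real Nz powr (2/3) * real Nz powr (1/3)" by (simp only: powr_add)
  also have "\<dots> \<le> real Nz powr (2/3) * real Nz powr (2/3)"
    using False by (intro mult_left_mono powr_mono) auto
  also have "\<dots> \<le> real Nz powr (2/3) * real N powr (2/3)"
    using assms by (intro mult_left_mono powr_mono2) auto
  finally show ?thesis by (simp add: rate_def)
qed (simp add: rate_def)

lemma radius_nonneg: "0 \<le> radius N Nz t"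
  by (simp add: radius_def)

lemma radius_pos: "1 \<le> Nz \<Longrightarrow> Nz \<le> N \<Longrightarrow> 1 \<le> t \<Longrightarrow> 0 < radius N Nz t"
  by (simp add: radius_def)

lemma radius_eq: "radius N Nz t = real Nz powr (1/6) * real N powr (-1/3) * real t powr (-1/3)"
  unfolding radius_def powr_minus_third by simp

text \<open>The relative decrease is at most \<open>1 / (t + 1)\<close>, so the motion of the
  reference point gains the same factor \<open>1 / t\<close> as the other errors.\<close>

lemma radius_step:
  assumes "1 \<le> t"
  shows "radius N Nz t - radius N Nz (Suc t) \<le> radius N Nz t / real t"
proof -
  have "real t / real (Suc t) * radius N Nz t
      = (real Nz powr (1/6) * real N powr (-1/3)) * (real t / real (Suc t) * real t powr (-1/3))"
    unfolding radius_eq by (simp only: mult_ac)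
  also have "\<dots> \<le> radius N Nz (Suc t)"
    unfolding radius_eq using powr_minus_third_step[OF assms] by (intro mult_left_mono) auto
  finally have "radius N Nz t - radius N Nz (Suc t) \<le> (1 - real t / real (Suc t)) * radius N Nz t"
    by (simp add: algebra_simps)
  also have "\<dots> \<le> (1 / real t) * radius N Nz t"
    using assms radius_nonneg by (intro mult_right_mono) (auto simp: field_simps)
  finally show ?thesis by simp
qed

lemma radius_antimono:
  assumes "1 \<le> t"
  shows "radius N Nz (Suc t) \<le> radius N Nz t"
  using assms unfolding radius_eq by (intro mult_left_mono powr_mono2') auto

text \<open>The exponents add up to 1 - 1/3 for \<open>N\<close> and 1/6 + 1/2 for
  \<open>Nz\<close>, so the left side equals the zeroth-order summand of the rate.\<close>

lemma radius_bias_le_rate: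
  assumes "Nz \<le> N" "1 \<le> N"
  shows "real N * (radius N Nz t * sqrt (real Nz)) \<le> rate N Nz t"
proof -
  have "real N * (radius N Nz t * sqrt (real Nz))
      = (real N powr 1 * real N powr (-1/3)) * (real Nz powr (1/6) * real Nz powr (1/2)) * real t powr (-1/3)"
    unfolding radius_eq by (simp add: powr_half_sqrt mult_ac)
  also have "\<dots> = real Nz powr (2/3) * real N powr (2/3) * real t powr (-1/3)"
    unfolding powr_add[symmetric] by simp
  also have "\<dots> \<le> rate N Nz t" using assms by (simp add: rate_def)
  finally show ?thesis .
qed

lemma radius_le_rate:
  assumes "Nz \<le> N" "1 \<le> N"
  shows "real Nz * radius N Nz t \<le> rate N Nz t"
proof (cases "Nz = 0")
  case False
  have "real Nz * radius N Nz t \<le> real N * (radius N Nz t * sqrt (real Nz))"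
    using assms False radius_nonneg[of N Nz t] by (intro mult_mono) (auto simp: mult_le_cancel_left1)
  then show ?thesis using radius_bias_le_rate[OF assms] by (rule order_trans)
qed (use rate_nonneg assms in auto)

text \<open>\<open>Nz / (\<delta>^2 * t)\<close> is again exactly the zeroth-order summand of the
  rate, and \<open>(N - Nz) / t\<close> is the first-order one.\<close>

lemma radius_variance_le_rate:
  assumes "Nz \<le> N" "1 \<le> N" "1 \<le> t" "0 \<le> a" "0 \<le> b"
  shows "(real Nz * (a / radius N Nz t)\<^sup>2 + (real N - real Nz) * b\<^sup>2) / (real t)\<^sup>2 \<le> (a\<^sup>2 + b\<^sup>2) * rate N Nz t / real t"
proof -
  let ?A = "real Nz powr (2/3) * real N powr (2/3) * real t powr (-1/3)" and ?F = "(real N - real Nz) * real t powr (-1)"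
  have "real Nz * (1 / radius N Nz t)\<^sup>2 / real t = ?A"
  \<comment> \<open>For \<open>Nz = 0\<close> the radius vanishes, but the prefactor
    \<open>real Nz\<close> makes both sides 0.\<close>
  proof (cases "Nz = 0")
    case False
    have sq: "(x powr p) ^ 2 = x powr (2 * p)" for x p :: real
      by (simp add: power2_eq_square powr_add[symmetric])
    have "real Nz * (1 / radius N Nz t)\<^sup>2 / real t
      = (real Nz powr 1 * real Nz powr (-(1/3))) * real N powr (2/3) * (real t powr (2/3) * real t powr (-1))"
      using False assms unfolding radius_def
      by (simp add: power_divide power_mult_distrib sq powr_minus field_simps)
    also have "\<dots> = ?A" unfolding powr_add[symmetric] by simp
    finally show ?thesis .
  qed simp
  moreover have "?F = (real N - real Nz) / real t" by (simp add: powr_minus_divide)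
  moreover have "(real Nz * (a / radius N Nz t)\<^sup>2 + (real N - real Nz) * b\<^sup>2) / real t
      = a\<^sup>2 * (real Nz * (1 / radius N Nz t)\<^sup>2 / real t) + b\<^sup>2 * ((real N - real Nz) / real t)"
    by (simp add: power_divide add_divide_distrib mult_ac)
  ultimately have "(real Nz * (a / radius N Nz t)\<^sup>2 + (real N - real Nz) * b\<^sup>2) / real t = a\<^sup>2 * ?A + b\<^sup>2 * ?F"
    by simp
  also have "\<dots> \<le> (a\<^sup>2 + b\<^sup>2) * rate N Nz t"
  proof -
    have "0 \<le> a\<^sup>2 * ?F" "0 \<le> b\<^sup>2 * ?A" using assms by auto
    then show ?thesis unfolding rate_def by (simp only: distrib_left distrib_right)
  qed
  finally show ?thesis using assms by (simp add: power2_eq_square divide_right_mono flip: divide_divide_eq_left)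
qed

section \<open>Measurability\<close>

context smooth_monotone_game
begin

text \<open>Costs and gradients are arbitrary off the joint action set, so measurability is obtained for
  their composition with the nonexpansive retraction onto that set.\<close>

definition retraction :: "(nat \<Rightarrow> 'a) \<Rightarrow> nat \<Rightarrow> 'a" where
  "retraction x = (\<lambda>i\<in>{1..N}. closest_point (X i) (x i))"

lemma retraction_joint: "retraction x \<in> joint_actions N X"
  using closest_point_in_set[OF X_closed] X_0 by (force simp: retraction_def joint_actions_def)

lemma retraction_self:
  assumes "x \<in> joint_actions N X"
  shows "retraction x = x"
proof (rule PiE_ext[of _ "{1..N}" X])
  show "retraction x \<in> (\<Pi>\<^sub>E i\<in>{1..N}. X i)" "x \<in> (\<Pi>\<^sub>E i\<in>{1..N}. X i)"
    using retraction_joint assms by (auto simp: joint_actions_def)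
  show "retraction x i = x i" if "i \<in> {1..N}" for i
    using closest_point_self[OF joint_actions_nth[OF assms that]] that by (simp add: retraction_def)
qed

lemma joint_dist_retraction_le: "joint_dist N (retraction x) (retraction y) \<le> joint_dist N x y"
  unfolding joint_dist_def
proof (rule L2_set_mono)
  fix i assume i: "i \<in> {1..N}"
  then have "X i \<noteq> {}" using X_0 by blast
  from closest_point_lipschitz[OF X_convex[OF i] X_closed[OF i] this]
  show "norm (retraction x i - retraction y i) \<le> norm (x i - y i)"
    using i by (simp add: retraction_def dist_norm)
qed simp

text \<open>\<open>joint_dist\<close> involves finitely many coordinates and is continuous in the
  product topology, so \<open>h\<close> composed with \<open>retraction\<close> is continuous on the
  whole function space. Coordinatewise measurability of \<open>f\<close> suffices, since outside
  \<open>{1..N}\<close> joint actions are constantly \<open>undefined\<close>.\<close>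

lemma measurable_lipschitz_joint:
  fixes h :: "(nat \<Rightarrow> 'a) \<Rightarrow> 'b::real_normed_vector" and f :: "'w \<Rightarrow> nat \<Rightarrow> 'a"
  assumes h: "\<And>x y. x \<in> joint_actions N X \<Longrightarrow> y \<in> joint_actions N X \<Longrightarrow> norm (h x - h y) \<le> L * joint_dist N x y"
    and L: "0 \<le> L"
    and f: "\<And>i. i \<in> {1..N} \<Longrightarrow> (\<lambda>w. f w i) \<in> borel_measurable M"
    and joint: "\<And>w. w \<in> space M \<Longrightarrow> f w \<in> joint_actions N X"
  shows "(\<lambda>w. h (f w)) \<in> borel_measurable M"
proof -
  have dist0: "((\<lambda>y. joint_dist N y x) \<longlongrightarrow> 0) (at x)" for x :: "nat \<Rightarrow> 'a"
  proof -
    have "continuous_on UNIV (\<lambda>y::nat \<Rightarrow> 'a. sqrt (\<Sum>i=1..N. (norm (y i - x i))\<^sup>2))"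
      by (intro continuous_intros continuous_on_product_coordinates)
    then have "((\<lambda>y. sqrt (\<Sum>i=1..N. (norm (y i - x i))\<^sup>2)) \<longlongrightarrow> sqrt (\<Sum>i=1..N. (norm (x i - x i))\<^sup>2)) (at x)"
      unfolding continuous_on_def by blast
    then show ?thesis by (simp add: joint_dist_def L2_set_def)
  qed
  have "((\<lambda>y. h (retraction y)) \<longlongrightarrow> h (retraction x)) (at x)" for x
  proof (rule Lim_transform_bound[THEN LIM_zero_cancel[of _ _ _]])
    show "\<forall>\<^sub>F y in at x. norm (h (retraction y) - h (retraction x)) \<le> norm (L * joint_dist N y x)"
    proof (rule always_eventually, rule allI)
      fix y
      have "norm (h (retraction y) - h (retraction x)) \<le> L * joint_dist N (retraction y) (retraction x)"
        by (intro h retraction_joint)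
      also have "\<dots> \<le> L * joint_dist N y x" using L joint_dist_retraction_le by (intro mult_left_mono) auto
      finally show "norm (h (retraction y) - h (retraction x)) \<le> norm (L * joint_dist N y x)" by simp
    qed
    show "((\<lambda>y. L * joint_dist N y x) \<longlongrightarrow> 0) (at x)"
      using tendsto_mult_right_zero[OF dist0] .
  qed
  then have "continuous_on UNIV (\<lambda>y. h (retraction y))"
    by (simp add: continuous_on_def)
  then have hm: "(\<lambda>y. h (retraction y)) \<in> borel_measurable borel" by (rule borel_measurable_continuous_onI)
  have "f \<in> borel_measurable M"
  proof (rule measurable_coordinatewise_then_product)
    fix i
    show "(\<lambda>w. f w i) \<in> borel_measurable M"
    proof (cases "i \<in> {1..N}")
      case False
      then have "f w i = undefined" if "w \<in> space M" for w
        using joint[OF that] by (auto simp: joint_actions_def PiE_iff extensional_def)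
      then show ?thesis by (subst measurable_cong[where g = "\<lambda>_. undefined"]) auto
    qed (rule f)
  qed
  from measurable_compose[OF this hm] show ?thesis
    by (subst measurable_cong[where g = "\<lambda>w. h (retraction (f w))"]) (simp_all add: retraction_self joint)
qed

lemma measurable_cost:
  assumes "i \<in> {1..N}" "\<And>j. j \<in> {1..N} \<Longrightarrow> (\<lambda>w. f w j) \<in> borel_measurable M"
    "\<And>w. w \<in> space M \<Longrightarrow> f w \<in> joint_actions N X"
  shows "(\<lambda>w. C i (f w)) \<in> borel_measurable M"
  using pos by (intro measurable_lipschitz_joint[OF _ _ assms(2,3), where L = L0]) (auto intro: C_lipschitz assms(1))

lemma measurable_gradient:
  assumes "i \<in> {1..N}" "\<And>j. j \<in> {1..N} \<Longrightarrow> (\<lambda>w. f w j) \<in> borel_measurable M"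
    "\<And>w. w \<in> space M \<Longrightarrow> f w \<in> joint_actions N X"
  shows "(\<lambda>w. G i (f w)) \<in> borel_measurable M"
  using pos by (intro measurable_lipschitz_joint[OF _ _ assms(2,3), where L = L1]) (auto intro: G_lipschitz assms(1))

end

context asym_round
begin

lemma measurable_estimate:
  assumes i: "i \<in> {1..N}"
    and u: "\<And>j. j \<in> {1..Nz} \<Longrightarrow> (\<lambda>w. u w j) \<in> borel_measurable M"
    and x: "\<And>j. j \<in> {1..N} \<Longrightarrow> (\<lambda>w. x w j) \<in> borel_measurable M"
    and unit: "\<And>w. w \<in> space M \<Longrightarrow> unit_directions (u w)"
    and feas: "\<And>w. w \<in> space M \<Longrightarrow> feasible (x w)"
  shows "(\<lambda>w. estimate (u w) (x w) i) \<in> borel_measurable M"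
proof -
  have p: "(\<lambda>w. played Nz \<delta> (u w) (x w) j) \<in> borel_measurable M" if "j \<in> {1..N}" for j
    using u[of j] x[OF that] by (cases "j \<in> {1..Nz}") (auto simp: played_def)
  have pj: "played Nz \<delta> (u w) (x w) \<in> joint_actions N X" if "w \<in> space M" for w
    using played_joint[OF feas[OF that], of "u w"] unit_directions_le[OF unit[OF that]] by blast
  show ?thesis
  proof (cases "i \<le> Nz")
    case True
    then have "(\<lambda>w. u w i) \<in> borel_measurable M" using u[of i] i by simp
    then show ?thesis
      using measurable_cost[OF i p pj] True by (simp add: estimate_def)
  next
    case False
    then show ?thesis using measurable_gradient[OF i p pj] by (simp add: estimate_def)
  qed
qed

lemma measurable_asym_step:
  assumes i: "i \<in> {1..N}"
    and u: "\<And>j. j \<in> {1..Nz} \<Longrightarrow> (\<lambda>w. u w j) \<in> borel_measurable M"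
    and x: "\<And>j. j \<in> {1..N} \<Longrightarrow> (\<lambda>w. x w j) \<in> borel_measurable M"
    and unit: "\<And>w. w \<in> space M \<Longrightarrow> unit_directions (u w)"
    and feas: "\<And>w. w \<in> space M \<Longrightarrow> feasible (x w)"
  shows "(\<lambda>w. asym_step N Nz X C G r \<delta> \<eta> \<eta> (u w) (x w) i) \<in> borel_measurable M"
proof -
  have "region i \<noteq> {}" using target_in_region[OF i] by blast
  then have "continuous_on UNIV (closest_point (region i))"
    by (intro continuous_on_closest_point region_convex region_closed i)
  moreover have "(\<lambda>w. x w i - \<eta> *\<^sub>R estimate (u w) (x w) i) \<in> borel_measurable M"
    using x[OF i] measurable_estimate[OF i u x unit feas] by auto
  ultimately show ?thesis
    unfolding asym_step_nth[OF i] by (rule borel_measurable_continuous_on)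
qed

end

section \<open>Expected decay\<close>

text \<open>The iterate of episode \<open>t\<close> uses only directions of earlier episodes, so
  even the case \<open>s = t\<close> leaves it unchanged. This is the form in which independence
  enters.\<close>

lemma asym_iterate_upd:
  "t \<le> s \<Longrightarrow> asym_iterate N Nz X C G r \<delta> \<eta>z \<eta>f x1 (w((i, s) := y)) t = asym_iterate N Nz X C G r \<delta> \<eta>z \<eta>f x1 w t"
  by (induction t) auto

lemma prob_space_directions: "prob_space (directions Nz T :: (nat \<times> nat \<Rightarrow> 'a::euclidean_space) measure)"
  unfolding directions_def by (rule prob_space_PiM) (rule prob_space_uniform_sphere)

lemma norm_direction:
  assumes "w \<in> space (directions Nz T)" "i \<in> {1..Nz}" "t \<in> {1..T}"
  shows "norm (w (i, t) :: 'a::euclidean_space) = 1"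
proof -
  have "w (i, t) \<in> space (uniform_sphere :: 'a measure)"
    using assms by (auto simp: directions_def space_PiM)
  then show ?thesis by (simp add: space_uniform_sphere)
qed

lemma measurable_direction:
  assumes "i \<in> {1..Nz}" "t \<in> {1..T}"
  shows "(\<lambda>w. w (i, t)) \<in> borel_measurable (directions Nz T :: (nat \<times> nat \<Rightarrow> 'a::euclidean_space) measure)"
proof -
  have "(\<lambda>w. w (i, t)) \<in> measurable (directions Nz T) (uniform_sphere :: 'a measure)"
    unfolding directions_def using assms by (intro measurable_component_singleton) auto
  moreover have "(\<lambda>u::'a. u) \<in> borel_measurable uniform_sphere"
    by (rule borel_measurable_uniform_sphere) simp
  ultimately show ?thesis by (rule measurable_compose)
qed

section \<open>The run over all episodes\<close>

locale asym_run = smooth_monotone_game N X C G m r D U L0 L1 xs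
  for N :: nat and X :: "nat \<Rightarrow> 'a::euclidean_space set" and C :: "nat \<Rightarrow> (nat \<Rightarrow> 'a) \<Rightarrow> real"
    and G :: "nat \<Rightarrow> (nat \<Rightarrow> 'a) \<Rightarrow> 'a" and m r D U L0 L1 :: real and xs :: "nat \<Rightarrow> 'a" +
  fixes Nz T :: nat and \<delta> \<eta>z \<eta>f :: "nat \<Rightarrow> real" and x1 :: "nat \<Rightarrow> 'a"
  assumes N_pos: "1 \<le> N" and Nz_le: "Nz \<le> N"
    and \<delta>_eq: "\<And>t. t \<in> {1..T} \<Longrightarrow> \<delta> t = radius N Nz t"
    and \<eta>z_eq: "\<And>t. t \<in> {1..T} \<Longrightarrow> \<eta>z t = 1 / (m * real t)"
    and \<eta>f_eq: "\<And>t. t \<in> {1..T} \<Longrightarrow> \<eta>f t = 1 / (m * real t)"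
    and x1_joint: "x1 \<in> joint_actions N X"
    and \<delta>_less: "\<And>t. 1 \<le> Nz \<Longrightarrow> t \<in> {1..T} \<Longrightarrow> \<delta> t < r"
    and x1_shrunk: "\<And>i. i \<in> {1..Nz} \<Longrightarrow> x1 i \<in> shrunk_set r (\<delta> 1) (X i)"
begin

abbreviation iter :: "(nat \<times> nat \<Rightarrow> 'a) \<Rightarrow> nat \<Rightarrow> nat \<Rightarrow> 'a" where
  "iter \<equiv> asym_iterate N Nz X C G r \<delta> \<eta>z \<eta>f x1"

abbreviation law :: "(nat \<times> nat \<Rightarrow> 'a) measure" where
  "law \<equiv> directions Nz T"

abbreviation target_at :: "nat \<Rightarrow> nat \<Rightarrow> 'a" where
  "target_at t \<equiv> asym_round.target r xs Nz (\<delta> t)"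

text \<open>The distance is measured to the shrunk equilibrium \<open>(1 - \<delta>\<^sub>t / r) x\<^sup>*\<close> rather than to \<open>x\<^sup>*\<close>: moving
  the reference point costs only \<open>\<delta>\<^sub>t - \<delta>\<^sub>t\<^sub>+\<^sub>1\<close> per episode, whereas projecting onto the shrunk set
  with reference point \<open>x\<^sup>*\<close> would cost \<open>\<delta>\<^sub>t\<close>, which is not summable against the contraction.\<close>

definition lyapunov :: "nat \<Rightarrow> (nat \<times> nat \<Rightarrow> 'a) \<Rightarrow> real" where
  "lyapunov t w = (\<Sum>i=1..N. (norm (iter w t i - target_at t i))\<^sup>2)"

text \<open>The summands are the bias, including the loss of passing strong monotonicity to the
  shrunk equilibrium, the second moment with \<open>1 / m\<^sup>2\<close> from the squared step
  size, and the motion of the reference point.\<close>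

definition decay_const :: real where
  "decay_const = 2 / m * (m * (2 * D\<^sup>2 / r) + drift_const) + ((real DIM('a) * U)\<^sup>2 + grad_bound\<^sup>2) / m\<^sup>2 + 2 * D\<^sup>2 / r"

lemma round: "t \<in> {1..T} \<Longrightarrow> asym_round N X C G m r D U L0 L1 xs Nz (\<delta> t)"
  using \<delta>_less radius_pos[of Nz N t] radius_nonneg Nz_le
  by unfold_locales (auto simp: \<delta>_eq)

lemma iter_Suc:
  assumes "t \<in> {1..T}"
  shows "iter w (Suc t) = asym_step N Nz X C G r (\<delta> t) (1 / (m * real t)) (1 / (m * real t)) (\<lambda>i. w (i, t)) (iter w t)"
  using assms by (simp add: \<eta>z_eq \<eta>f_eq)

text \<open>A step lands in the region of the current radius, which is contained in that of the next
  because the radius decreases.\<close>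

lemma iter_feasible:
  assumes "1 \<le> t" "t \<le> T"
  shows "asym_round.feasible N X r Nz (\<delta> t) (iter w t)"
  using assms
proof (induction t rule: dec_induct)
  case base
  interpret R: asym_round N X C G m r D U L0 L1 xs Nz "\<delta> 1" using base by (intro round) simp
  show ?case
    using x1_joint x1_shrunk joint_actions_nth[OF x1_joint] unfolding R.feasible_def R.region_def by auto
next
  case (step t)
  interpret R: asym_round N X C G m r D U L0 L1 xs Nz "\<delta> t" using step by (intro round) simp
  interpret S: asym_round N X C G m r D U L0 L1 xs Nz "\<delta> (Suc t)" using step by (intro round) simp
  have le: "\<delta> (Suc t) \<le> \<delta> t" using step radius_antimono[of t N Nz] by (simp add: \<delta>_eq)
  have tT: "t \<in> {1..T}" using step by simp
  have f: "R.feasible (iter w (Suc t))" unfolding iter_Suc[OF tT] by (rule R.asym_step_feasible)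
  have "R.region i \<subseteq> S.region i" if "i \<in> {1..N}" for i
    using shrunk_set_antimono[OF X_convex[OF that] X_0[OF that] S.\<delta>_nonneg le R.\<delta>_less] that
    by (auto simp: R.region_def S.region_def)
  then show ?case using f unfolding R.feasible_def S.feasible_def by blast
qed

lemma unit_directions_law:
  assumes "w \<in> space law" "t \<in> {1..T}"
  shows "asym_round.unit_directions Nz (\<lambda>i. w (i, t))"
proof -
  interpret R: asym_round N X C G m r D U L0 L1 xs Nz "\<delta> t" by (rule round[OF assms(2)])
  show ?thesis using norm_direction[OF assms(1) _ assms(2)] by (simp add: R.unit_directions_def)
qed

lemma measurable_iter:
  assumes "1 \<le> t" "t \<le> T" "i \<in> {1..N}"
  shows "(\<lambda>w. iter w t i) \<in> borel_measurable law"
  using assms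
proof (induction t arbitrary: i rule: dec_induct)
  case base
  then show ?case by simp
next
  case (step t)
  have tT: "t \<in> {1..T}" using step by simp
  interpret R: asym_round N X C G m r D U L0 L1 xs Nz "\<delta> t" by (rule round[OF tT])
  show ?case
    unfolding iter_Suc[OF tT]
  proof (rule R.measurable_asym_step[OF step.prems(2)])
    show "(\<lambda>w. w (j, t)) \<in> borel_measurable law" if "j \<in> {1..Nz}" for j
      by (rule measurable_direction[OF that tT])
    show "R.unit_directions (\<lambda>j. w (j, t))" if "w \<in> space law" for w
      by (rule unit_directions_law[OF that tT])
  qed (use step iter_feasible in auto)
qed

lemma integrable_law_bounded:
  fixes f :: "(nat \<times> nat \<Rightarrow> 'a) \<Rightarrow> real"
  assumes "f \<in> borel_measurable law" "\<And>w. w \<in> space law \<Longrightarrow> \<bar>f w\<bar> \<le> b"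
  shows "integrable law f"
proof -
  interpret prob_space law by (rule prob_space_directions)
  show ?thesis using assms by (intro integrable_const_bound[where B = b]) auto
qed

lemma norm_iter_target_le:
  assumes "1 \<le> t" "t \<le> T" "i \<in> {1..N}"
  shows "norm (iter w t i - target_at t i) \<le> D"
proof -
  interpret R: asym_round N X C G m r D U L0 L1 xs Nz "\<delta> t" using assms by (intro round) simp
  show ?thesis by (rule R.feasible_target_dist[OF iter_feasible[OF assms(1,2)] assms(3)])
qed

lemma integrable_sum_sq_dist:
  assumes t: "1 \<le> t" "t \<le> T" and y: "\<And>i. i \<in> {1..N} \<Longrightarrow> y i \<in> X i"
  shows "integrable law (\<lambda>w. \<Sum>i=1..N. (norm (iter w t i - y i))\<^sup>2)"
proof (rule Bochner_Integration.integrable_sum)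
  fix i assume i: "i \<in> {1..N}"
  show "integrable law (\<lambda>w. (norm (iter w t i - y i))\<^sup>2)"
  proof (rule integrable_law_bounded)
    show "(\<lambda>w. (norm (iter w t i - y i))\<^sup>2) \<in> borel_measurable law"
      using measurable_iter[OF t i] by measurable
    fix w
    interpret R: asym_round N X C G m r D U L0 L1 xs Nz "\<delta> t" using t by (intro round) simp
    have "iter w t i \<in> X i"
      by (rule joint_actions_nth[OF R.feasible_joint[OF iter_feasible[OF t]] i])
    then have "norm (iter w t i - y i) \<le> D" by (rule X_dist[OF i _ y[OF i]])
    then show "\<bar>(norm (iter w t i - y i))\<^sup>2\<bar> \<le> D\<^sup>2" by (simp add: power_mono)
  qed
qed

lemma target_at_in_X: "t \<in> {1..T} \<Longrightarrow> i \<in> {1..N} \<Longrightarrow> target_at t i \<in> X i"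
  using asym_round.target_in_region[OF round] asym_round.region_subset[OF round] by blast

lemma integrable_lyapunov: "1 \<le> t \<Longrightarrow> t \<le> T \<Longrightarrow> integrable law (lyapunov t)"
  unfolding lyapunov_def by (rule integrable_sum_sq_dist) (auto intro: target_at_in_X)

text \<open>\<open>excess\<close> is the slack in the drift bound. For a zeroth-order agent it can
  be negative on single draws, so its own direction is integrated out with the rest frozen; for a
  first-order agent it is nonnegative pointwise.\<close>

lemma expected_drift_nonneg:
  assumes t: "t \<in> {1..T}" and i: "i \<in> {1..N}"
  defines "excess \<equiv> \<lambda>w. asym_round.estimate C G Nz (\<delta> t) (\<lambda>j. w (j, t)) (iter w t) i \<bullet> (iter w t i - target_at t i)
      - G i (iter w t) \<bullet> (iter w t i - xs i) + drift_const * (\<delta> t * sqrt (real Nz))"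
  shows "integrable law excess" and "0 \<le> (\<integral>w. excess w \<partial>law)"
proof -
  interpret R: asym_round N X C G m r D U L0 L1 xs Nz "\<delta> t" by (rule round[OF t])
  interpret S: prob_space "uniform_sphere :: 'a measure" by (rule prob_space_uniform_sphere)
  have t': "1 \<le> t" "t \<le> T" using t by auto
  let ?e = "drift_const * (\<delta> t * sqrt (real Nz))"
  let ?eb = "if i \<le> Nz then real DIM('a) * U / \<delta> t else grad_bound"
  have feas: "R.feasible (iter w t)" for w by (rule iter_feasible[OF t'])
  have joint: "iter w t \<in> joint_actions N X" for w by (rule R.feasible_joint[OF feas])
  have unit: "R.unit_directions (\<lambda>j. w (j, t))" if "w \<in> space law" for w
    by (rule unit_directions_law[OF that t])
  show int: "integrable law excess"
  proof (rule integrable_law_bounded)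
    have "(\<lambda>w. R.estimate (\<lambda>j. w (j, t)) (iter w t) i) \<in> borel_measurable law"
      by (rule R.measurable_estimate[OF i]) (auto intro!: measurable_direction t measurable_iter[OF t'] unit feas)
    moreover have "(\<lambda>w. G i (iter w t)) \<in> borel_measurable law"
      by (rule measurable_gradient[OF i measurable_iter[OF t'] joint])
    ultimately show "excess \<in> borel_measurable law"
      unfolding excess_def using measurable_iter[OF t' i] by measurable
    fix w assume w: "w \<in> space law"
    have "\<bar>R.estimate (\<lambda>j. w (j, t)) (iter w t) i \<bullet> (iter w t i - target_at t i)\<bar> \<le> ?eb * D"
      using R.norm_estimate_le[OF feas unit[OF w] i] norm_iter_target_le[OF t' i]
      by (intro order_trans[OF Cauchy_Schwarz_ineq2 mult_mono']) auto
    moreover have "\<bar>G i (iter w t) \<bullet> (iter w t i - xs i)\<bar> \<le> grad_bound * D"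
      using norm_G_le[OF i joint] X_dist[OF i joint_actions_nth[OF joint i] joint_actions_nth[OF xs_joint i]]
      by (intro order_trans[OF Cauchy_Schwarz_ineq2 mult_mono']) auto
    ultimately show "\<bar>excess w\<bar> \<le> ?eb * D + grad_bound * D + \<bar>?e\<bar>"
      unfolding excess_def by linarith
  qed
  show "0 \<le> (\<integral>w. excess w \<partial>law)"
  proof (cases "i \<le> Nz")
    case True
    then have iz: "i \<in> {1..Nz}" using i by simp
    have "0 \<le> (\<integral>y. excess (w((i, t) := y)) \<partial>uniform_sphere)" if w: "w \<in> space law" for w
    proof -
      let ?est = "\<lambda>y. R.estimate ((\<lambda>j. w (j, t))(i := y)) (iter w t) i \<bullet> (iter w t i - target_at t i)"
      let ?c = "G i (iter w t) \<bullet> (iter w t i - xs i) - ?e"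
      \<comment> \<open>Overwriting coordinate \<open>(i, t)\<close> affects only the direction of
        agent \<open>i\<close> in this episode.\<close>
      have "(\<lambda>j. (w((i, t) := y)) (j, t)) = (\<lambda>j. w (j, t))(i := y)" for y by auto
      then have eq: "excess (w((i, t) := y)) = ?est y - ?c" for y
        unfolding excess_def asym_iterate_upd[OF order_refl] by (simp only:)
      note drift = R.drift_zeroth_order[OF feas unit[OF w] iz, of w]
      have "?c \<le> (\<integral>y. ?est y \<partial>uniform_sphere)" by (rule drift(2))
      then show ?thesis unfolding eq using drift(1) by (simp add: S.prob_space)
    qed
    then show ?thesis
      using int iz t unfolding directions_def
      by (intro integral_PiM_nonneg_coordinate[where p = "(i, t)"] prob_space_uniform_sphere) auto
  next
    case False
    show ?thesis
    proof (rule integral_nonneg_AE, rule AE_I2)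
      fix w assume "w \<in> space law"
      then show "0 \<le> excess w"
        unfolding excess_def using R.drift_first_order[OF feas unit i, of w w] False by simp
    qed
  qed
qed

lemma reference_shift:
  assumes t: "1 \<le> t" "Suc t \<le> T"
  shows "lyapunov (Suc t) w \<le> (\<Sum>i=1..N. (norm (iter w (Suc t) i - target_at t i))\<^sup>2)
    + 2 * D\<^sup>2 / r * (real Nz * (\<delta> t - \<delta> (Suc t)))"
proof -
  interpret R: asym_round N X C G m r D U L0 L1 xs Nz "\<delta> t" using t by (intro round) simp
  interpret S: asym_round N X C G m r D U L0 L1 xs Nz "\<delta> (Suc t)" using t by (intro round) simp
  have le: "\<delta> (Suc t) \<le> \<delta> t" using t radius_antimono[of t N Nz] by (simp add: \<delta>_eq)
  have tT: "t \<in> {1..T}" using t by simp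
  \<comment> \<open>The new iterate was projected onto the old region, hence is within
    \<open>D\<close> of the old target too; both distances must be bounded for the comparison of
    squares.\<close>
  have f: "R.feasible (iter w (Suc t))" unfolding iter_Suc[OF tT] by (rule R.asym_step_feasible)
  have "(norm (iter w (Suc t) i - S.target i))\<^sup>2 \<le> (norm (iter w (Suc t) i - R.target i))\<^sup>2
      + (if i \<le> Nz then 2 * D\<^sup>2 / r * (\<delta> t - \<delta> (Suc t)) else 0)" if i: "i \<in> {1..N}" for i
  proof (cases "i \<le> Nz")
    case True
    have "iter w (Suc t) i - S.target i - (iter w (Suc t) i - R.target i) = - (((\<delta> t - \<delta> (Suc t)) / r) *\<^sub>R xs i)"
      using True by (simp add: R.target_def S.target_def algebra_simps diff_divide_distrib)
    then have "norm (iter w (Suc t) i - S.target i - (iter w (Suc t) i - R.target i)) = (\<delta> t - \<delta> (Suc t)) / r * norm (xs i)"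
      using le pos by (simp only: norm_minus_cancel norm_scaleR) simp
    also have "\<dots> \<le> (\<delta> t - \<delta> (Suc t)) / r * D"
      using X_norm[OF i joint_actions_nth[OF xs_joint i]] le pos by (intro mult_left_mono) auto
    finally have "2 * D * norm (iter w (Suc t) i - S.target i - (iter w (Suc t) i - R.target i))
        \<le> 2 * D * ((\<delta> t - \<delta> (Suc t)) / r * D)"
      using pos by (intro mult_left_mono) auto
    also have "\<dots> = 2 * D\<^sup>2 / r * (\<delta> t - \<delta> (Suc t))" by (simp add: power2_eq_square)
    finally show ?thesis
      using power2_norm_diff_le[OF norm_iter_target_le[OF _ t(2) i] R.feasible_target_dist[OF f i], of w] True
      by simp
  qed (simp add: R.target_def S.target_def)
  then have "lyapunov (Suc t) w \<le> (\<Sum>i=1..N. (norm (iter w (Suc t) i - target_at t i))\<^sup>2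
      + (if i \<le> Nz then 2 * D\<^sup>2 / r * (\<delta> t - \<delta> (Suc t)) else 0))"
    unfolding lyapunov_def by (rule sum_mono)
  also have "\<dots> = (\<Sum>i=1..N. (norm (iter w (Suc t) i - target_at t i))\<^sup>2)
      + 2 * D\<^sup>2 / r * (real Nz * (\<delta> t - \<delta> (Suc t)))"
    unfolding sum.distrib sum_first_agents[OF Nz_le] by simp
  finally show ?thesis .
qed

text \<open>Adding \<open>2 * \<eta>\<close> times the total excess makes the descent inequality
  hold pathwise with the true gradients; after integration the excess is discarded by its
  sign.\<close>

lemma expected_lyapunov_step:
  assumes t: "1 \<le> t" "Suc t \<le> T"
  shows "(\<integral>w. lyapunov (Suc t) w \<partial>law) \<le> (1 - 2 / real t) * (\<integral>w. lyapunov t w \<partial>law)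
    + 2 / (m * real t) * (m * (2 * D\<^sup>2 / r) * (real Nz * \<delta> t) + drift_const * (real N * (\<delta> t * sqrt (real Nz))))
    + (1 / (m * real t))\<^sup>2 * (real Nz * (real DIM('a) * U / \<delta> t)\<^sup>2 + (real N - real Nz) * grad_bound\<^sup>2)
    + 2 * D\<^sup>2 / r * (real Nz * (\<delta> t - \<delta> (Suc t)))"
proof -
  have tT: "t \<in> {1..T}" "t \<le> T" using t by auto
  interpret R: asym_round N X C G m r D U L0 L1 xs Nz "\<delta> t" by (rule round[OF tT(1)])
  interpret P: prob_space law by (rule prob_space_directions)
  define \<eta> where "\<eta> = 1 / (m * real t)"
  have \<eta>: "0 \<le> \<eta>" "2 * \<eta> * m = 2 / real t" using pos t by (auto simp: \<eta>_def)
  define e where "e = drift_const * (\<delta> t * sqrt (real Nz))"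
  define V where "V = real Nz * (real DIM('a) * U / \<delta> t)\<^sup>2 + (real N - real Nz) * grad_bound\<^sup>2"
  define B where "B = m * (2 * D\<^sup>2 / r) * (real Nz * \<delta> t)"
  define S where "S = (\<lambda>w. \<Sum>i=1..N. (norm (iter w (Suc t) i - target_at t i))\<^sup>2)"
  define exc where "exc = (\<lambda>i w. R.estimate (\<lambda>j. w (j, t)) (iter w t) i \<bullet> (iter w t i - target_at t i)
      - G i (iter w t) \<bullet> (iter w t i - xs i) + e)"
  have exc: "integrable law (exc i)" "0 \<le> (\<integral>w. exc i w \<partial>law)" if "i \<in> {1..N}" for i
    using expected_drift_nonneg[OF tT(1) that] by (simp_all add: exc_def e_def)
  have int_exc: "integrable law (\<lambda>w. \<Sum>i=1..N. exc i w)"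
    by (rule Bochner_Integration.integrable_sum) (rule exc(1))
  have sum_exc: "(\<integral>w. (\<Sum>i=1..N. exc i w) \<partial>law) = (\<Sum>i=1..N. \<integral>w. exc i w \<partial>law)"
    by (rule Bochner_Integration.integral_sum) (rule exc(1))
  have intS: "integrable law S"
    unfolding S_def by (rule integrable_sum_sq_dist[OF _ t(2)]) (auto intro: target_at_in_X tT(1))
  have "S w + 2 * \<eta> * (\<Sum>i=1..N. exc i w)
      \<le> (1 - 2 / real t) * lyapunov t w + (2 * \<eta> * (B + real N * e) + \<eta>\<^sup>2 * V)" if w: "w \<in> space law" for w
  proof -
    have feas: "R.feasible (iter w t)" by (rule iter_feasible[OF t(1) tT(2)])
    have sumexc: "(\<Sum>i=1..N. exc i w) = (\<Sum>i=1..N. R.estimate (\<lambda>j. w (j, t)) (iter w t) i \<bullet> (iter w t i - target_at t i))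
        - (\<Sum>i=1..N. G i (iter w t) \<bullet> (iter w t i - xs i)) + real N * e"
      unfolding exc_def sum.distrib sum_subtractf by simp
    have "S w \<le> lyapunov t w
        - 2 * \<eta> * (\<Sum>i=1..N. R.estimate (\<lambda>j. w (j, t)) (iter w t) i \<bullet> (iter w t i - target_at t i)) + \<eta>\<^sup>2 * V"
      using R.asym_step_descent[OF feas unit_directions_law[OF w tT(1)], of \<eta>]
      unfolding iter_Suc[OF tT(1)] \<eta>_def[symmetric] lyapunov_def V_def S_def .
    then have "S w + 2 * \<eta> * (\<Sum>i=1..N. exc i w) \<le> lyapunov t w
        - 2 * \<eta> * (\<Sum>i=1..N. G i (iter w t) \<bullet> (iter w t i - xs i)) + 2 * \<eta> * (real N * e) + \<eta>\<^sup>2 * V"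
      unfolding sumexc by (simp only: distrib_left right_diff_distrib)
    also have "\<dots> \<le> lyapunov t w - 2 * \<eta> * (m * lyapunov t w - B) + 2 * \<eta> * (real N * e) + \<eta>\<^sup>2 * V"
      using mult_left_mono[OF R.sum_gradient_ge[OF feas], of "2 * \<eta>"] \<eta>(1)
      unfolding lyapunov_def B_def by simp
    also have "2 * \<eta> * (m * lyapunov t w - B) = 2 / real t * lyapunov t w - 2 * \<eta> * B"
      unfolding \<eta>(2)[symmetric] by (simp add: right_diff_distrib)
    finally show ?thesis by (simp add: left_diff_distrib distrib_left)
  qed
  then have "(\<integral>w. S w + 2 * \<eta> * (\<Sum>i=1..N. exc i w) \<partial>law)
      \<le> (\<integral>w. (1 - 2 / real t) * lyapunov t w + (2 * \<eta> * (B + real N * e) + \<eta>\<^sup>2 * V) \<partial>law)"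
    using intS int_exc integrable_lyapunov[OF t(1) tT(2)] by (intro integral_mono) auto
  also have "\<dots> = (1 - 2 / real t) * (\<integral>w. lyapunov t w \<partial>law) + (2 * \<eta> * (B + real N * e) + \<eta>\<^sup>2 * V)"
    using integrable_lyapunov[OF t(1) tT(2)] by (simp add: P.prob_space)
  finally have 1: "(\<integral>w. S w \<partial>law) + 2 * \<eta> * (\<Sum>i=1..N. \<integral>w. exc i w \<partial>law)
      \<le> (1 - 2 / real t) * (\<integral>w. lyapunov t w \<partial>law) + (2 * \<eta> * (B + real N * e) + \<eta>\<^sup>2 * V)"
    using intS int_exc by (simp add: sum_exc del: One_nat_def)
  have 2: "0 \<le> 2 * \<eta> * (\<Sum>i=1..N. \<integral>w. exc i w \<partial>law)"
    using \<eta>(1) exc(2) by (intro mult_nonneg_nonneg sum_nonneg) auto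
  have "(\<integral>w. lyapunov (Suc t) w \<partial>law) \<le> (\<integral>w. S w + 2 * D\<^sup>2 / r * (real Nz * (\<delta> t - \<delta> (Suc t))) \<partial>law)"
    using intS integrable_lyapunov[OF _ t(2)] reference_shift[OF t] unfolding S_def by (intro integral_mono) auto
  also have "\<dots> = (\<integral>w. S w \<partial>law) + 2 * D\<^sup>2 / r * (real Nz * (\<delta> t - \<delta> (Suc t)))"
    using intS by (simp add: P.prob_space)
  finally have 3: "(\<integral>w. lyapunov (Suc t) w \<partial>law) \<le> (\<integral>w. S w \<partial>law) + 2 * D\<^sup>2 / r * (real Nz * (\<delta> t - \<delta> (Suc t)))" .
  have 4: "2 * \<eta> * (B + real N * e) = 2 / (m * real t) * (B + drift_const * (real N * (\<delta> t * sqrt (real Nz))))"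
    by (simp add: \<eta>_def e_def mult_ac)
  show ?thesis using 1[unfolded 4] 2 3 unfolding V_def B_def \<eta>_def by linarith
qed

lemma decay_const_pos: "0 < decay_const"
  using pos drift_const_pos unfolding decay_const_def
  by (intro add_pos_nonneg mult_pos_pos) auto

lemma expected_lyapunov_recursion:
  assumes t: "1 \<le> t" "Suc t \<le> T"
  shows "(\<integral>w. lyapunov (Suc t) w \<partial>law) \<le> (1 - 2 / real t) * (\<integral>w. lyapunov t w \<partial>law)
    + decay_const / real t * rate N Nz t"
proof -
  let ?R = "rate N Nz t"
  have \<delta>t: "\<delta> t = radius N Nz t" "\<delta> (Suc t) = radius N Nz (Suc t)" using t by (auto simp: \<delta>_eq)
  have "m * (2 * D\<^sup>2 / r) * (real Nz * \<delta> t) + drift_const * (real N * (\<delta> t * sqrt (real Nz)))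
      \<le> m * (2 * D\<^sup>2 / r) * ?R + drift_const * ?R"
    unfolding \<delta>t using radius_le_rate[OF Nz_le N_pos] radius_bias_le_rate[OF Nz_le N_pos] pos drift_const_pos
    by (intro add_mono mult_left_mono) auto
  then have "2 / (m * real t) * (m * (2 * D\<^sup>2 / r) * (real Nz * \<delta> t) + drift_const * (real N * (\<delta> t * sqrt (real Nz))))
      \<le> 2 / (m * real t) * (m * (2 * D\<^sup>2 / r) * ?R + drift_const * ?R)"
    using pos t by (intro mult_left_mono) auto
  also have "\<dots> = 2 / m * (m * (2 * D\<^sup>2 / r) + drift_const) * (?R / real t)"
    by (simp add: algebra_simps)
  finally have bias: "2 / (m * real t) * (m * (2 * D\<^sup>2 / r) * (real Nz * \<delta> t) + drift_const * (real N * (\<delta> t * sqrt (real Nz))))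
      \<le> 2 / m * (m * (2 * D\<^sup>2 / r) + drift_const) * (?R / real t)" .
  have "(1 / (m * real t))\<^sup>2 * (real Nz * (real DIM('a) * U / \<delta> t)\<^sup>2 + (real N - real Nz) * grad_bound\<^sup>2)
      = 1 / m\<^sup>2 * ((real Nz * (real DIM('a) * U / \<delta> t)\<^sup>2 + (real N - real Nz) * grad_bound\<^sup>2) / (real t)\<^sup>2)"
    by (simp add: power_mult_distrib power_divide)
  also have "\<dots> \<le> 1 / m\<^sup>2 * (((real DIM('a) * U)\<^sup>2 + grad_bound\<^sup>2) * ?R / real t)"
    unfolding \<delta>t using radius_variance_le_rate[OF Nz_le N_pos t(1)] pos grad_bound_pos
    by (intro mult_left_mono) auto
  finally have var: "(1 / (m * real t))\<^sup>2 * (real Nz * (real DIM('a) * U / \<delta> t)\<^sup>2 + (real N - real Nz) * grad_bound\<^sup>2)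
      \<le> ((real DIM('a) * U)\<^sup>2 + grad_bound\<^sup>2) / m\<^sup>2 * (?R / real t)" by simp
  have "real Nz * (\<delta> t - \<delta> (Suc t)) \<le> real Nz * (radius N Nz t / real t)"
    unfolding \<delta>t using radius_step[OF t(1)] by (intro mult_left_mono) auto
  also have "\<dots> \<le> ?R / real t"
    using divide_right_mono[OF radius_le_rate[OF Nz_le N_pos], of "real t" t] by simp
  finally have "2 * D\<^sup>2 / r * (real Nz * (\<delta> t - \<delta> (Suc t))) \<le> 2 * D\<^sup>2 / r * (?R / real t)"
    using pos by (intro mult_left_mono) auto
  then have "(\<integral>w. lyapunov (Suc t) w \<partial>law) \<le> (1 - 2 / real t) * (\<integral>w. lyapunov t w \<partial>law)
      + (2 / m * (m * (2 * D\<^sup>2 / r) + drift_const) * (?R / real t)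
      + ((real DIM('a) * U)\<^sup>2 + grad_bound\<^sup>2) / m\<^sup>2 * (?R / real t) + 2 * D\<^sup>2 / r * (?R / real t))"
    using expected_lyapunov_step[OF t] bias var by linarith
  also have "\<dots> = (1 - 2 / real t) * (\<integral>w. lyapunov t w \<partial>law) + decay_const * (?R / real t)"
    unfolding decay_const_def by (simp only: distrib_right)
  finally show ?thesis by simp
qed

text \<open>In the constant, \<open>D\<^sup>2\<close> covers the initial distance and
  \<open>2 * decay_const\<close> is what the first step of the recursion demands.\<close>

lemma expected_lyapunov_le:
  assumes T: "1 \<le> T"
  shows "(\<integral>w. lyapunov T w \<partial>law) \<le> (D\<^sup>2 + 2 * decay_const) * rate N Nz T"
proof (rule contraction_recursion[where E = "\<lambda>t. \<integral>w. lyapunov t w \<partial>law" and \<phi> = "rate N Nz"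
      and c = decay_const and T = T])
  interpret P: prob_space law by (rule prob_space_directions)
  have "(\<integral>w. lyapunov 1 w \<partial>law) \<le> (\<integral>w. real N * D\<^sup>2 \<partial>law)"
  proof (rule integral_mono[OF integrable_lyapunov])
    fix w
    have "lyapunov 1 w \<le> (\<Sum>i=1..N. D\<^sup>2)"
      unfolding lyapunov_def using norm_iter_target_le[OF _ T] by (intro sum_mono power_mono) auto
    then show "lyapunov 1 w \<le> real N * D\<^sup>2" by simp
  qed (use T in auto)
  also have "\<dots> = D\<^sup>2 * real N" by (simp add: P.prob_space)
  also have "\<dots> \<le> D\<^sup>2 * rate N Nz 1" using agents_le_rate[OF Nz_le] by (intro mult_left_mono) auto
  also have "\<dots> \<le> (D\<^sup>2 + 2 * decay_const) * rate N Nz 1"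
    using decay_const_pos rate_nonneg[OF Nz_le] by (intro mult_right_mono) auto
  finally show "(\<integral>w. lyapunov 1 w \<partial>law) \<le> (D\<^sup>2 + 2 * decay_const) * rate N Nz 1" .
  show "0 \<le> (\<integral>w. lyapunov t w \<partial>law)" for t
    unfolding lyapunov_def by (intro integral_nonneg_AE AE_I2 sum_nonneg) auto
qed (use decay_const_pos T rate_nonneg[OF Nz_le] expected_lyapunov_recursion rate_slow[OF Nz_le] in auto)

lemma expected_dist_le:
  assumes T: "1 \<le> T"
  shows "integrable law (\<lambda>w. (joint_dist N (iter w T) xs)\<^sup>2)"
    and "(\<integral>w. (joint_dist N (iter w T) xs)\<^sup>2 \<partial>law) \<le> (D\<^sup>2 + 2 * decay_const + 2 * D\<^sup>2 / r) * rate N Nz T"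
proof -
  interpret R: asym_round N X C G m r D U L0 L1 xs Nz "\<delta> T" using T by (intro round) simp
  interpret P: prob_space law by (rule prob_space_directions)
  show int: "integrable law (\<lambda>w. (joint_dist N (iter w T) xs)\<^sup>2)"
    unfolding power2_joint_dist by (rule integrable_sum_sq_dist[OF T order_refl joint_actions_nth[OF xs_joint]])
  have "(joint_dist N (iter w T) xs)\<^sup>2 \<le> lyapunov T w + 2 * D\<^sup>2 / r * (real Nz * \<delta> T)" for w
    unfolding lyapunov_def by (rule R.dist_le_target_dist[OF iter_feasible[OF T order_refl]])
  then have "(\<integral>w. (joint_dist N (iter w T) xs)\<^sup>2 \<partial>law) \<le> (\<integral>w. lyapunov T w + 2 * D\<^sup>2 / r * (real Nz * \<delta> T) \<partial>law)"
    using int integrable_lyapunov[OF T order_refl] by (intro integral_mono) auto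
  also have "\<dots> = (\<integral>w. lyapunov T w \<partial>law) + 2 * D\<^sup>2 / r * (real Nz * \<delta> T)"
    using integrable_lyapunov[OF T order_refl] by (simp add: P.prob_space)
  also have "\<dots> \<le> (D\<^sup>2 + 2 * decay_const) * rate N Nz T + 2 * D\<^sup>2 / r * rate N Nz T"
    using expected_lyapunov_le[OF T] radius_le_rate[OF Nz_le N_pos, of T] \<delta>_eq[of T] T pos
    by (intro add_mono mult_left_mono) auto
  finally show "(\<integral>w. (joint_dist N (iter w T) xs)\<^sup>2 \<partial>law) \<le> (D\<^sup>2 + 2 * decay_const + 2 * D\<^sup>2 / r) * rate N Nz T"
    by (simp only: distrib_right)
qed

end

theorem theorem2:
  fixes m r D U L0 L1 :: real
  assumes "m > 0" "r > 0" "D > 0" "U > 0" "L0 > 0" "L1 > 0"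
  shows
    "\<exists>K>0. \<forall>(N::nat) (Nz::nat) (T::nat) (X :: nat \<Rightarrow> 'a::euclidean_space set)
        (C :: nat \<Rightarrow> (nat \<Rightarrow> 'a) \<Rightarrow> real) (G :: nat \<Rightarrow> (nat \<Rightarrow> 'a) \<Rightarrow> 'a)
        (\<delta> :: nat \<Rightarrow> real) (\<eta>z :: nat \<Rightarrow> real) (\<eta>f :: nat \<Rightarrow> real)
        (x1 :: nat \<Rightarrow> 'a) (xs :: nat \<Rightarrow> 'a).
      1 \<le> N \<longrightarrow> Nz \<le> N \<longrightarrow> 1 \<le> T \<longrightarrow>
      (\<forall>i\<in>{1..N}. closed (X i) \<and> convex (X i) \<and> cball 0 r \<subseteq> X i
          \<and> bounded (X i) \<and> diameter (X i) \<le> D) \<longrightarrow>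
      is_own_gradient N X C G \<longrightarrow>
      strongly_monotone N X G m \<longrightarrow>
      (\<forall>i\<in>{1..N}. \<forall>x\<in>joint_actions N X. convex_on (X i) (\<lambda>y. C i (x(i := y)))) \<longrightarrow>
      (\<forall>i\<in>{1..N}. \<forall>x\<in>joint_actions N X. \<bar>C i x\<bar> \<le> U) \<longrightarrow>
      (\<forall>i\<in>{1..N}. \<forall>x\<in>joint_actions N X. \<forall>y\<in>joint_actions N X.
          \<bar>C i x - C i y\<bar> \<le> L0 * joint_dist N x y) \<longrightarrow>
      (\<forall>i\<in>{1..N}. \<forall>x\<in>joint_actions N X. \<forall>y\<in>joint_actions N X.
          norm (G i x - G i y) \<le> L1 * joint_dist N x y) \<longrightarrow>
      (\<forall>t\<in>{1..T}. \<delta> t = real Nz powr (1/6) / (real N powr (1/3) * real t powr (1/3))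
          \<and> \<eta>z t = 1 / (m * real t) \<and> \<eta>f t = 1 / (m * real t)) \<longrightarrow>
      x1 \<in> joint_actions N X \<longrightarrow>
      (1 \<le> Nz \<longrightarrow> (\<forall>t\<in>{1..T}. \<delta> t < r) \<and> (\<forall>i\<in>{1..Nz}. x1 i \<in> shrunk_set r (\<delta> 1) (X i))) \<longrightarrow>
      nash_equilibrium N X C xs \<longrightarrow>
      integrable (directions Nz T)
        (\<lambda>\<omega>. (joint_dist N (asym_iterate N Nz X C G r \<delta> \<eta>z \<eta>f x1 \<omega> T) xs)\<^sup>2) \<and>
      (\<integral>\<omega>. (joint_dist N (asym_iterate N Nz X C G r \<delta> \<eta>z \<eta>f x1 \<omega> T) xs)\<^sup>2 \<partial>directions Nz T)
        \<le> K * (real Nz powr (2/3) * real N powr (2/3) * real T powr (-1/3)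
               + (real N - real Nz) * real T powr (-1))"
proof -
  \<comment> \<open>The constant must be fixed before the game is, so \<open>grad_bound\<close>,
    \<open>drift_const\<close> and \<open>decay_const\<close> are restated outside their locales;
    they involve neither \<open>N\<close> nor \<open>Nz\<close> nor \<open>T\<close>.\<close>
  define B where "B = L0 + 2 * L1 * D"
  define dc where "dc = D * (L1 + real DIM('a) * L1 + B / r)"
  define c where "c = 2 / m * (m * (2 * D\<^sup>2 / r) + dc) + ((real DIM('a) * U)\<^sup>2 + B\<^sup>2) / m\<^sup>2 + 2 * D\<^sup>2 / r"
  define K where "K = D\<^sup>2 + 2 * c + 2 * D\<^sup>2 / r"
  have "0 < B" using assms by (simp add: B_def add_pos_pos)
  then have "0 < dc" using assms by (simp add: dc_def add_pos_pos)
  then have "0 < c" using assms unfolding c_def by (intro add_pos_nonneg mult_pos_pos) auto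
  then have K: "0 < K" using assms unfolding K_def by (intro add_pos_nonneg) auto
  show ?thesis
  proof (intro exI[of _ K] conjI K allI impI)
    fix N Nz T :: nat and X :: "nat \<Rightarrow> 'a set" and C :: "nat \<Rightarrow> (nat \<Rightarrow> 'a) \<Rightarrow> real"
      and G :: "nat \<Rightarrow> (nat \<Rightarrow> 'a) \<Rightarrow> 'a" and \<delta> \<eta>z \<eta>f :: "nat \<Rightarrow> real" and x1 xs :: "nat \<Rightarrow> 'a"
    assume N: "1 \<le> N" "Nz \<le> N" and T: "1 \<le> T"
      and X: "\<forall>i\<in>{1..N}. closed (X i) \<and> convex (X i) \<and> cball 0 r \<subseteq> X i \<and> bounded (X i) \<and> diameter (X i) \<le> D"
      and grad: "is_own_gradient N X C G" and mono: "strongly_monotone N X G m"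
      and "\<forall>i\<in>{1..N}. \<forall>x\<in>joint_actions N X. convex_on (X i) (\<lambda>y. C i (x(i := y)))"
      and U: "\<forall>i\<in>{1..N}. \<forall>x\<in>joint_actions N X. \<bar>C i x\<bar> \<le> U"
      and L0: "\<forall>i\<in>{1..N}. \<forall>x\<in>joint_actions N X. \<forall>y\<in>joint_actions N X. \<bar>C i x - C i y\<bar> \<le> L0 * joint_dist N x y"
      and L1: "\<forall>i\<in>{1..N}. \<forall>x\<in>joint_actions N X. \<forall>y\<in>joint_actions N X.
          norm (G i x - G i y) \<le> L1 * joint_dist N x y"
      and steps: "\<forall>t\<in>{1..T}. \<delta> t = real Nz powr (1/6) / (real N powr (1/3) * real t powr (1/3))
          \<and> \<eta>z t = 1 / (m * real t) \<and> \<eta>f t = 1 / (m * real t)"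
      and x1: "x1 \<in> joint_actions N X"
        "1 \<le> Nz \<longrightarrow> (\<forall>t\<in>{1..T}. \<delta> t < r) \<and> (\<forall>i\<in>{1..Nz}. x1 i \<in> shrunk_set r (\<delta> 1) (X i))"
      and nash: "nash_equilibrium N X C xs"
    interpret smooth_monotone_game N X C G m r D U L0 L1 xs
      by unfold_locales (use assms X grad mono U L0 L1 nash in blast)+
    interpret asym_run N X C G m r D U L0 L1 xs Nz T \<delta> \<eta>z \<eta>f x1
    proof
      show "\<delta> t < r" if "1 \<le> Nz" "t \<in> {1..T}" for t using x1(2) that by blast
      show "x1 i \<in> shrunk_set r (\<delta> 1) (X i)" if "i \<in> {1..Nz}" for i using x1(2) that by auto
    qed (use N steps x1(1) in \<open>auto simp: radius_def\<close>)
    have "K = D\<^sup>2 + 2 * decay_const + 2 * D\<^sup>2 / r"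
      by (simp add: K_def c_def dc_def B_def decay_const_def drift_const_def grad_bound_def)
    then show "integrable (directions Nz T) (\<lambda>\<omega>. (joint_dist N (asym_iterate N Nz X C G r \<delta> \<eta>z \<eta>f x1 \<omega> T) xs)\<^sup>2)"
      and "(\<integral>\<omega>. (joint_dist N (asym_iterate N Nz X C G r \<delta> \<eta>z \<eta>f x1 \<omega> T) xs)\<^sup>2 \<partial>directions Nz T)
        \<le> K * (real Nz powr (2/3) * real N powr (2/3) * real T powr (-1/3)
               + (real N - real Nz) * real T powr (-1))"
      using expected_dist_le[OF T] by (simp_all only: rate_def)
  qed
qed

end
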